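(* Let $\lambda>0$ and let $\mathfrak{a}(x,\xi)$ be a smooth matrix-valued symbol on $\mathbb{R}^d\times\mathbb{R}^d$ such that, for some positive constants $c_{\boldsymbol\alpha\boldsymbol\beta}$ and all multi-indices with $|\boldsymbol\alpha|+|\boldsymbol\beta|\le100d$, $$|\partial_x^{\boldsymbol\alpha}\partial_\xi^{\boldsymbol\beta}\mathfrak{a}(x,\xi)|\le c_{\boldsymbol\alpha\boldsymbol\beta}\,\lambda^{-|\boldsymbol\beta|},\qquad \operatorname{supp}\mathfrak{a}\subseteq\{(x,\xi):\tfrac1{100}\lambda<|\xi|<100\lambda\}.$$ If $$\lambda\ge\max_{1\le|\boldsymbol\alpha|+|\boldsymbol\beta|\le10d}\left(\frac{c_{\boldsymbol\alpha\boldsymbol\beta}}{c_{00}}\right)^{\frac{2}{|\boldsymbol\alpha|+|\boldsymbol\beta|}},$$ then, for some universal constant $C>0$, $$\|\mathfrak{a}(x,D)\|_{L^2\to L^2}\le C\,c_{00}.$$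
   Context: $\mathfrak{a}(x,D)$ is the left quantization: $\mathfrak{a}(x,D)u(x)=\iint\mathfrak{a}(x,\xi)u(y)e^{i\xi\cdot(x-y)}\,dy\,\frac{d\xi}{(2\pi)^d}$. $c_{00}$ denotes $c_{\boldsymbol\alpha\boldsymbol\beta}$ with $\boldsymbol\alpha=\boldsymbol\beta=0$. "Universal" means independent of $\mathfrak a$, $\lambda$ and the $c_{\boldsymbol\alpha\boldsymbol\beta}$ (depending at most on the dimension $d$ and the matrix size). *)

theory Defs
  imports "HOL-Analysis.Analysis"
begin

section \<open>Partial derivatives and smoothness\<close>

definition partial_deriv ::
    "'a::real_normed_vector \<Rightarrow> ('a \<Rightarrow> 'b::real_normed_vector) \<Rightarrow> 'a \<Rightarrow> 'b"
  where "partial_deriv v f p = vector_derivative (\<lambda>t. f (p + t *\<^sub>R v)) (at 0)"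

text \<open>
  Class $C^\infty$: all iterated coordinate partial derivatives, of every order and in every
  order of differentiation, are Frechet differentiable everywhere (hence also continuous).
\<close>
definition smooth :: "('a::euclidean_space \<Rightarrow> 'b::real_normed_vector) \<Rightarrow> bool"
  where "smooth f \<longleftrightarrow>
    (\<forall>vs. set vs \<subseteq> Basis \<longrightarrow> foldr partial_deriv vs f differentiable_on UNIV)"

section \<open>Multi-indices\<close>

type_synonym 'd multi_index = "'d \<Rightarrow> nat"

definition order_mi :: "'d::finite multi_index \<Rightarrow> nat"
  where "order_mi \<alpha> = (\<Sum>i\<in>UNIV. \<alpha> i)"

text \<open>
  The index type carries no order, so an enumeration of the coordinates is chosen once and for
  all; for smooth functions the partial derivatives commute and the choice is immaterial.
\<close>
definition coords :: "'d::finite list"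
  where "coords = (SOME is. set is = UNIV \<and> distinct is)"

lemma set_coords: "set (coords :: 'd::finite list) = UNIV"
  and distinct_coords: "distinct (coords :: 'd::finite list)"
proof -
  have "\<exists>is :: 'd list. set is = UNIV \<and> distinct is"
    using finite_distinct_list[of "UNIV :: 'd set"] by auto
  then have "set (coords :: 'd list) = UNIV \<and> distinct (coords :: 'd list)"
    unfolding coords_def by (rule someI_ex)
  then show "set (coords :: 'd list) = UNIV" "distinct (coords :: 'd list)" by auto
qed

definition multi_deriv ::
    "('d::finite \<Rightarrow> 'a::real_normed_vector) \<Rightarrow> 'd multi_index \<Rightarrow>
      ('a \<Rightarrow> 'b::real_normed_vector) \<Rightarrow> 'a \<Rightarrow> 'b"
  where "multi_deriv e \<alpha> = foldr (\<lambda>i. partial_deriv (e i) ^^ \<alpha> i) coords"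

text \<open>The operator $\partial_x^\alpha \partial_\xi^\beta$ on functions of $(x,\xi)$.\<close>
definition symbol_deriv ::
    "'d::finite multi_index \<Rightarrow> 'd multi_index \<Rightarrow>
      ((real^'d) \<times> (real^'d) \<Rightarrow> 'b::real_normed_vector) \<Rightarrow> (real^'d) \<times> (real^'d) \<Rightarrow> 'b"
  where "symbol_deriv \<alpha> \<beta> a =
    multi_deriv (\<lambda>i. (axis i 1, 0)) \<alpha> (multi_deriv (\<lambda>i. (0, axis i 1)) \<beta> a)"

lemma finite_multi_index_pairs:
  "finite {(\<alpha> :: 'd::finite multi_index, \<beta> :: 'd multi_index).
     1 \<le> order_mi \<alpha> + order_mi \<beta> \<and> order_mi \<alpha> + order_mi \<beta> \<le> N}"
proof -
  have le: "\<gamma> i \<le> order_mi \<gamma>" for \<gamma> :: "'d multi_index" and i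
    unfolding order_mi_def by (rule member_le_sum) auto
  have fin: "finite (PiE UNIV (\<lambda>_::'d. {..N}))"
    by (rule finite_PiE) auto
  have "{(\<alpha> :: 'd multi_index, \<beta> :: 'd multi_index).
      1 \<le> order_mi \<alpha> + order_mi \<beta> \<and> order_mi \<alpha> + order_mi \<beta> \<le> N}
      \<subseteq> PiE UNIV (\<lambda>_. {..N}) \<times> PiE UNIV (\<lambda>_. {..N})"
    using le by (auto simp: PiE_UNIV_domain intro: order_trans)
      (meson add_leD1 add_leD2 le order_trans)+
  then show ?thesis
    by (rule finite_subset) (use fin in auto)
qed

section \<open>Quantization and the operator norm on \<open>L\<^sup>2\<close>\<close>

text \<open>
  For \<open>u\<close> in $L^1$ and \<open>a\<close> bounded with \<open>\<xi>\<close>-support in a bounded set, the double integral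
  converges absolutely.
\<close>
definition left_quantization ::
    "((real^'d::finite) \<times> (real^'d) \<Rightarrow> complex^'n::finite^'m::finite) \<Rightarrow>
      (real^'d \<Rightarrow> complex^'n) \<Rightarrow> real^'d \<Rightarrow> complex^'m"
  where "left_quantization a u x =
    (1 / (2 * pi) ^ CARD('d)) *\<^sub>R
      (LINT \<xi>|lborel. LINT y|lborel. cis (\<xi> \<bullet> (x - y)) *s (a (x, \<xi>) *v u y))"

definition L1_space :: "('a::euclidean_space \<Rightarrow> 'b::euclidean_space) set"
  where "L1_space = {u. integrable lborel u}"

definition L2_space :: "('a::euclidean_space \<Rightarrow> 'b::euclidean_space) set"
  where "L2_space = {u. u \<in> borel_measurable lborel \<and> integrable lborel (\<lambda>x. (norm (u x))\<^sup>2)}"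

definition L2_norm :: "('a::euclidean_space \<Rightarrow> 'b::euclidean_space) \<Rightarrow> real"
  where "L2_norm u = sqrt (LINT x|lborel. (norm (u x))\<^sup>2)"

text \<open>
  The $L^2 \to L^2$ norm of an operator given by its action on the dense subspace
  $L^1 \cap L^2$ of $L^2$, that is, the norm of its unique continuous extension to $L^2$.
  It is \<open>\<infinity>\<close> if the operator is unbounded or does not map into $L^2$.
\<close>
definition L2_opnorm ::
    "(('a::euclidean_space \<Rightarrow> 'b::euclidean_space) \<Rightarrow> 'a \<Rightarrow> 'c::euclidean_space) \<Rightarrow> ennreal"
  where "L2_opnorm T = Inf {ennreal K | K. 0 \<le> K \<and>
    (\<forall>u \<in> L1_space \<inter> L2_space. T u \<in> L2_space \<and> L2_norm (T u) \<le> K * L2_norm u)}"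

end

theory Submission
  imports Defs "HOL-Probability.Probability" "HOL-Real_Asymp.Real_Asymp"
begin

text \<open>
  After rescaling, the statement is a theorem of Calderon and Vaillancourt. Put \<open>m = sqrt lam\<close>. The lower
  bound on \<open>lam\<close> says that \<open>c \<alpha> \<beta>\<close> is at most \<open>c 0 0 * m ^ (|\<alpha>| + |\<beta>|)\<close>, so that a derivative of the symbol
  of order \<open>\<alpha>\<close> in \<open>x\<close> and \<open>\<beta>\<close> in \<open>\<xi>\<close> is at most \<open>c 0 0\<close> times \<open>m\<close> to the power \<open>|\<alpha>| - |\<beta>|\<close>. Only multi-indices
  with entries 0 and 1 are used. The proof freezes the position variable in the spirit of Hwang's
  elementary proof, and needs neither almost orthogonality nor the inversion of the Fourier transform.

  Let \<open>e\<close> be the product over the coordinates of the densities \<open>m exp (- m r)\<close>, \<open>r \<ge> 0\<close>. A bounded smooth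
  function \<open>f\<close> with bounded derivatives is the convolution of \<open>e\<close> with the product of the operators
  \<open>1 + (1 / m) \<partial>\<^sub>j\<close> applied to \<open>f\<close> (\<open>exponential_average_fst\<close>). Integration by parts in \<open>\<xi>\<close> turns the symbol
  \<open>a\<close> into \<open>b\<close>, the product of the operators \<open>1 - m \<partial>\<^sub>j\<close> in \<open>\<xi>\<close> applied to \<open>a\<close>, at the price of the factor
  \<open>\<phi> (x - y)\<close> in the kernel, where \<open>\<phi> z\<close> is the product of \<open>1 / (1 + i m z\<^sub>j)\<close> (\<open>fourier_shift_derivs\<close>). Then
  both \<open>b\<close>, as a function of \<open>x\<close>, and \<open>\<phi>\<close> are written as averages against \<open>e\<close>, of a symbol \<open>B\<close> with
  \<open>|B| \<le> 4\<^sup>d c 0 0\<close> and of a square integrable function \<open>\<psi>\<close> respectively. Up to the factor \<open>(2 \<pi>)\<^sup>d\<close>, the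
  operator becomes the integral over \<open>s\<close> and \<open>t\<close> of \<open>e (x - t) * e (x - s) * H s t x\<close>, where \<open>H s t x\<close> is the
  integral over \<open>\<xi>\<close> of \<open>exp (i \<xi> x) * B (s, \<xi>)\<close> times the Fourier transform at \<open>- \<xi>\<close> of \<open>\<psi> (t - y) * u y\<close>.

  In \<open>H s t x\<close> the variable \<open>x\<close> is left in the exponential only. Hence Plancherel's inequality
  (\<open>Plancherel_le\<close>), used in \<open>x\<close> and again in \<open>y\<close>, bounds the square integral of \<open>H s t\<close> in \<open>x\<close> by the square
  integral of \<open>\<psi> (t - y) * u y\<close> in \<open>y\<close>. The Cauchy-Schwarz inequality with the probability densities \<open>e\<close>, and
  the bound of \<open>e (x - t) * e (x - s)\<close> by an integrable function of \<open>t - s\<close>, reduce the claim to the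
  integrals of that function and of \<open>|\<psi>|\<^sup>2\<close>; the powers of \<open>m\<close> in them cancel
  (\<open>nn_integral_localized_quantization_le\<close>). Matrix symbols are treated entry by entry.
\<close>

section \<open>Lebesgue integrals on Euclidean spaces\<close>

lemma product_sigma_finite_lborel: "product_sigma_finite (\<lambda>_. lborel :: real measure)"
  by standard

text \<open>
  Lebesgue measure on a Euclidean space, in the coordinates given by the canonical basis.
\<close>

lemma lborel_PiM:
  fixes g :: "'a::euclidean_space \<Rightarrow> 'c::{banach,second_countable_topology}"
  assumes [measurable]: "g \<in> borel_measurable borel"
  shows "integrable lborel g \<longleftrightarrow>
      integrable (PiM Basis (\<lambda>_. lborel)) (\<lambda>f. g (\<Sum>b\<in>Basis. f b *\<^sub>R b))"
    and "integral\<^sup>L lborel g =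
      (LINT f|PiM Basis (\<lambda>_. lborel). g (\<Sum>b\<in>Basis. f b *\<^sub>R b))"
   by (subst lborel_eq, subst integrable_distr_eq integral_distr; simp)+

lemma lborel_integral_prod:
  fixes f :: "'a::euclidean_space \<Rightarrow> real \<Rightarrow> 'c::{real_normed_field,banach,second_countable_topology}"
  assumes f: "\<And>b. b \<in> Basis \<Longrightarrow> integrable lborel (f b)"
  shows "integrable lborel (\<lambda>x. \<Prod>b\<in>Basis. f b (x \<bullet> b))"
    and "(LINT x|lborel. (\<Prod>b\<in>Basis. f b (x \<bullet> b))) = (\<Prod>b\<in>Basis. integral\<^sup>L lborel (f b))"
proof -
  interpret product_sigma_finite "\<lambda>_::'a. lborel :: real measure"
    by (rule product_sigma_finite_lborel)
  have [measurable]: "f b \<in> borel_measurable borel" if "b \<in> Basis" for b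
    using f[OF that] by auto
  have eq: "(\<Prod>b\<in>Basis. f b ((\<Sum>c\<in>Basis. g c *\<^sub>R c) \<bullet> b)) = (\<Prod>b\<in>Basis. f b (g b))" for g
    by (intro prod.cong refl) simp
  show "integrable lborel (\<lambda>x. \<Prod>b\<in>Basis. f b (x \<bullet> b))"
    by (subst lborel_PiM) (auto simp: eq intro!: product_integrable_prod f)
  show "(LINT x|lborel. (\<Prod>b\<in>Basis. f b (x \<bullet> b))) = (\<Prod>b\<in>Basis. integral\<^sup>L lborel (f b))"
    by (subst lborel_PiM) (auto simp: eq intro!: product_integral_prod f)
qed

text \<open>
  Every exchange of two Bochner integrals below is an instance of this rule: the integrand is dominated
  by a product of two integrable functions of one variable each.
\<close>

lemma Fubini_dominated:
  fixes F :: "'a::euclidean_space \<Rightarrow> 'b::euclidean_space \<Rightarrow> 'c::{banach,second_countable_topology}"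
  assumes F: "case_prod F \<in> borel_measurable (borel \<Otimes>\<^sub>M borel)"
    and g: "integrable lborel g" and h: "integrable lborel h"
    and le: "\<And>x y. norm (F x y) \<le> g x * h y"
  shows "(LINT x|lborel. LINT y|lborel. F x y) = (LINT y|lborel. LINT x|lborel. F x y)"
    and "integrable lborel (\<lambda>x. LINT y|lborel. F x y)"
proof -
  have F'[measurable]: "case_prod F \<in> borel_measurable (lborel \<Otimes>\<^sub>M lborel)"
    using F by (simp add: lborel_prod borel_prod)
  have gh: "integrable (lborel \<Otimes>\<^sub>M lborel) (\<lambda>(x, y). g x * h y)"
    using g h by (intro lborel_pair.Fubini_integrable) (auto simp: abs_mult)
  have i: "integrable (lborel \<Otimes>\<^sub>M lborel) (case_prod F)"
    by (rule Bochner_Integration.integrable_bound[OF gh F']) (intro AE_I2, use le in \<open>clarsimp, meson order_trans abs_ge_self\<close>)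
  show "(LINT x|lborel. LINT y|lborel. F x y) = (LINT y|lborel. LINT x|lborel. F x y)"
    using lborel_pair.Fubini_integral[OF i] by simp
  show "integrable lborel (\<lambda>x. LINT y|lborel. F x y)"
    using lborel_pair.integrable_fst'[OF i] by simp
qed

lemma nn_integral_lborel_reflect:
  fixes f :: "'a::euclidean_space \<Rightarrow> ennreal"
  assumes [measurable]: "f \<in> borel_measurable borel"
  shows "(\<integral>\<^sup>+ z. f (y - z) \<partial>lborel) = integral\<^sup>N lborel f"
proof -
  have l: "lborel = distr lborel borel (\<lambda>x::'a. y - x)"
    using lborel_affine[of "-1::real" y] by (simp add: density_1)
  have "integral\<^sup>N lborel f = integral\<^sup>N (distr lborel borel (\<lambda>x::'a. y - x)) f"
    by (subst l) simp
  then show ?thesis by (subst (asm) nn_integral_distr) auto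
qed

lemma lborel_integral_reflect:
  fixes f :: "'a::euclidean_space \<Rightarrow> 'c::{banach,second_countable_topology}"
  assumes [measurable]: "f \<in> borel_measurable borel"
  shows "(LINT z|lborel. f (y - z)) = integral\<^sup>L lborel f"
proof -
  have l: "lborel = distr lborel borel (\<lambda>x::'a. y - x)"
    using lborel_affine[of "-1::real" y] by (simp add: density_1)
  have "integral\<^sup>L lborel f = integral\<^sup>L (distr lborel borel (\<lambda>x::'a. y - x)) f"
    by (subst l) simp
  then show ?thesis by (subst (asm) integral_distr) auto
qed

lemma nn_integral_lborel_translate:
  fixes f :: "'a::euclidean_space \<Rightarrow> ennreal"
  assumes [measurable]: "f \<in> borel_measurable borel"
  shows "(\<integral>\<^sup>+ z. f (z - y) \<partial>lborel) = integral\<^sup>N lborel f"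
proof -
  have "(\<integral>\<^sup>+ z. f (z - y) \<partial>lborel) = (\<integral>\<^sup>+ z. f z \<partial>distr lborel borel ((+) (-y)))"
    by (subst nn_integral_distr) auto
  then show ?thesis by (simp add: lborel_distr_plus)
qed

lemma lborel_integral_translate:
  fixes f :: "'a::euclidean_space \<Rightarrow> 'c::{banach,second_countable_topology}"
  assumes [measurable]: "f \<in> borel_measurable borel"
  shows "(LINT z|lborel. f (z + y)) = integral\<^sup>L lborel f"
proof -
  have "(LINT z|lborel. f (z + y)) = (LINT z|distr lborel borel ((+) y). f z)"
    by (subst integral_distr) (auto simp: add.commute)
  then show ?thesis by (simp add: lborel_distr_plus)
qed

lemma norm_integral_le_nn_integral:
  fixes f :: "'a \<Rightarrow> 'b::{banach,second_countable_topology}"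
  shows "ennreal (norm (integral\<^sup>L M f)) \<le> (\<integral>\<^sup>+ x. ennreal (norm (f x)) \<partial>M)"
  by (cases "integrable M f")
    (auto intro: integral_norm_bound_ennreal simp: not_integrable_integral_eq)

lemma norm_integral_le_dominated:
  fixes f :: "'a \<Rightarrow> 'b::{banach,second_countable_topology}"
  assumes "integrable M g" "\<And>x. norm (f x) \<le> g x"
  shows "norm (integral\<^sup>L M f) \<le> integral\<^sup>L M g"
  by (rule order_trans[OF integral_norm_bound])
    (intro integral_mono' assms, auto intro: order_trans[OF norm_ge_zero assms(2)])

lemma integrable_indicator_cball:
  "integrable lborel (indicator (cball (c::'a::euclidean_space) r) :: 'a \<Rightarrow> real)"
  using emeasure_bounded_finite[OF bounded_cball, of c r] by (intro integrable_real_indicator) simp_all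

lemma nn_integral_weighted_square_le:
  assumes [measurable]: "w \<in> borel_measurable M" "h \<in> borel_measurable M"
    and w: "\<And>x. 0 \<le> w x" "(\<integral>\<^sup>+ x. ennreal (w x) \<partial>M) \<le> 1"
  shows "(\<integral>\<^sup>+ x. ennreal (w x) * h x \<partial>M)\<^sup>2 \<le> (\<integral>\<^sup>+ x. ennreal (w x) * (h x)\<^sup>2 \<partial>M)"
proof -
  let ?s = "\<lambda>x. ennreal (sqrt (w x))"
  have s: "ennreal (w x) = ?s x * ?s x" for x
    using w(1)[of x] by (simp flip: ennreal_mult)
  have "(\<integral>\<^sup>+ x. ennreal (w x) * h x \<partial>M)\<^sup>2 = (\<integral>\<^sup>+ x. ?s x * (?s x * h x) \<partial>M)\<^sup>2"
    by (simp only: s mult.assoc)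
  also have "\<dots> \<le> (\<integral>\<^sup>+ x. (?s x)\<^sup>2 \<partial>M) * (\<integral>\<^sup>+ x. (?s x * h x)\<^sup>2 \<partial>M)"
    by (rule Cauchy_Schwarz_nn_integral) measurable
  also have "\<dots> = (\<integral>\<^sup>+ x. ennreal (w x) \<partial>M) * (\<integral>\<^sup>+ x. ennreal (w x) * (h x)\<^sup>2 \<partial>M)"
    by (simp only: s power2_eq_square mult_ac)
  also have "\<dots> \<le> 1 * (\<integral>\<^sup>+ x. ennreal (w x) * (h x)\<^sup>2 \<partial>M)"
    using w(2) by (intro mult_right_mono) auto
  finally show ?thesis by simp
qed

section \<open>Plancherel's inequality\<close>

text \<open>
  The Fourier transform with the kernel \<open>exp (i \<xi> y)\<close>, without a normalizing factor; the transform
  with the opposite sign is its value at \<open>- \<xi>\<close>.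
\<close>

definition fourier :: "('a::euclidean_space \<Rightarrow> complex) \<Rightarrow> 'a \<Rightarrow> complex"
  where "fourier f \<xi> = (LINT y|lborel. cis (\<xi> \<bullet> y) * f y)"

lemma cis_eq_exp: "cis t = exp (\<i> * complex_of_real t)"
  by (simp add: cis_conv_exp)

lemma borel_measurable_cis[measurable (raw)]:
  "f \<in> borel_measurable M \<Longrightarrow> (\<lambda>x. cis (f x)) \<in> borel_measurable M"
  unfolding cis_eq_exp by measurable

lemma borel_measurable_cnj[measurable (raw)]:
  "f \<in> borel_measurable M \<Longrightarrow> (\<lambda>x. cnj (f x)) \<in> borel_measurable M"
  by (rule borel_measurable_continuous_on[of cnj]) (auto intro: continuous_intros)

lemma borel_measurable_fourier[measurable]:
  assumes [measurable]: "f \<in> borel_measurable borel"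
  shows "fourier f \<in> borel_measurable borel"
proof -
  have "(\<lambda>\<xi>. LINT y|lborel. cis (\<xi> \<bullet> y) * f y) \<in> borel_measurable lborel"
    by (rule lborel.borel_measurable_lebesgue_integral) measurable
  then show ?thesis unfolding fourier_def[abs_def] by simp
qed

lemma norm_fourier_le: "norm (fourier f \<xi>) \<le> (LINT y|lborel. norm (f y))"
  unfolding fourier_def by (rule order_trans[OF integral_norm_bound]) (simp add: norm_mult)

lemma fourier_Gaussian_real:
  assumes s: "s > 0"
  shows "integrable lborel (\<lambda>x. complex_of_real (exp (- x\<^sup>2 / (2 * s\<^sup>2))))"
    and "fourier (\<lambda>x. complex_of_real (exp (- x\<^sup>2 / (2 * s\<^sup>2)))) t =
      2 * pi * normal_density 0 (1 / s) t"
proof -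
  have e: "exp (- x\<^sup>2 / (2 * s\<^sup>2)) = sqrt (2 * pi) * s * normal_density 0 s x" for x
    using s by (simp add: normal_density_def real_sqrt_mult)
  show "integrable lborel (\<lambda>x. complex_of_real (exp (- x\<^sup>2 / (2 * s\<^sup>2))))"
    unfolding e using s by (intro integrable_of_real integrable_mult_right) auto
  have "fourier (\<lambda>x. complex_of_real (exp (- x\<^sup>2 / (2 * s\<^sup>2)))) t =
     s *\<^sub>R (LINT x|lborel. cis (t * (0 + s * x)) * complex_of_real (exp (- (0 + s * x)\<^sup>2 / (2 * s\<^sup>2))))"
    unfolding fourier_def using s by (subst lborel_integral_real_affine[where c=s and t=0]) auto
  also have "\<dots> = s *\<^sub>R (LINT x|lborel. sqrt (2 * pi) *\<^sub>R (std_normal_density x *\<^sub>R iexp ((s * t) * x)))"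
    using s by (intro arg_cong2[where f=scaleR] Bochner_Integration.integral_cong refl)
      (simp add: cis_conv_exp normal_density_def power_mult_distrib scaleR_conv_of_real mult_ac)
  also have "\<dots> = s *\<^sub>R sqrt (2 * pi) *\<^sub>R char std_normal_distribution (s * t)"
    unfolding char_def by (subst integral_scaleR_right, subst integral_density) (auto)
  also have "\<dots> = 2 * pi * normal_density 0 (1 / s) t"
    using s unfolding char_std_normal_distribution
    by (simp add: normal_density_def scaleR_conv_of_real power_mult_distrib power_divide real_sqrt_divide real_sqrt_mult field_simps
      flip: of_real_mult)
  finally show "fourier (\<lambda>x. complex_of_real (exp (- x\<^sup>2 / (2 * s\<^sup>2)))) t =
      2 * pi * normal_density 0 (1 / s) t" .
qed

text \<open>
  The Gaussian weight \<open>exp (- |x|\<^sup>2 / (2 s\<^sup>2))\<close>, written as a product over the coordinates.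
\<close>

definition gaussian :: "real \<Rightarrow> 'a::euclidean_space \<Rightarrow> real"
  where "gaussian s x = (\<Prod>b\<in>Basis. exp (- (x \<bullet> b)\<^sup>2 / (2 * s\<^sup>2)))"

text \<open>
  The Fourier transform of the Gaussian weight. For positive \<open>s\<close> it is \<open>(2 \<pi>)\<^sup>d\<close> times a probability density, so
  that its integral does not depend on \<open>s\<close>.
\<close>

definition gaussian_transform :: "real \<Rightarrow> 'a::euclidean_space \<Rightarrow> real"
  where "gaussian_transform s t = (\<Prod>b\<in>Basis. 2 * pi * normal_density 0 (1 / s) (t \<bullet> b))"

lemma borel_measurable_gaussian[measurable]: "gaussian s \<in> borel_measurable borel"
  unfolding gaussian_def[abs_def] by measurable

lemma borel_measurable_gaussian_transform[measurable]:
  "gaussian_transform s \<in> borel_measurable borel"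
  unfolding gaussian_transform_def[abs_def] by measurable

lemma gaussian_nonneg: "0 \<le> gaussian s x" "0 \<le> gaussian_transform s x"
  unfolding gaussian_def gaussian_transform_def by (auto intro!: prod_nonneg)

lemma integrable_gaussian: "s > 0 \<Longrightarrow> integrable lborel (gaussian s)"
  unfolding gaussian_def[abs_def]
  by (rule lborel_integral_prod(1)) (metis fourier_Gaussian_real(1) complex_of_real_integrable_eq)

lemma fourier_gaussian:
  fixes t :: "'a::euclidean_space"
  assumes "s > 0"
  shows "fourier (\<lambda>x. complex_of_real (gaussian s x)) t = gaussian_transform s t"
proof -
  have "cis (t \<bullet> y) = (\<Prod>b\<in>Basis. cis ((t \<bullet> b) * (y \<bullet> b)))" for y
    by (subst euclidean_inner) (simp add: cis_eq_exp sum_distrib_left exp_sum)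
  then have eq: "cis (t \<bullet> y) * complex_of_real (gaussian s y) =
     (\<Prod>b\<in>Basis. cis ((t \<bullet> b) * (y \<bullet> b)) * complex_of_real (exp (- (y \<bullet> b)\<^sup>2 / (2 * s\<^sup>2))))" for y
    by (simp add: gaussian_def prod.distrib)
  have "integrable lborel (\<lambda>x. cis (c * x) * complex_of_real (exp (- x\<^sup>2 / (2 * s\<^sup>2))))" for c :: real
    by (rule Bochner_Integration.integrable_bound[OF fourier_Gaussian_real(1)[OF assms]])
      (auto simp: norm_mult)
  then have "fourier (\<lambda>x. complex_of_real (gaussian s x)) t =
    (\<Prod>b\<in>Basis. fourier (\<lambda>x. complex_of_real (exp (- x\<^sup>2 / (2 * s\<^sup>2)))) (t \<bullet> b))"
    unfolding fourier_def eq by (subst lborel_integral_prod(2)) auto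
  also have "\<dots> = gaussian_transform s t"
    unfolding fourier_Gaussian_real(2)[OF assms] gaussian_transform_def by simp
  finally show ?thesis .
qed

lemma nn_integral_gaussian_transform:
  assumes "s > 0"
  shows "(\<integral>\<^sup>+ t. ennreal (gaussian_transform s (t :: 'a::euclidean_space)) \<partial>lborel) =
    ennreal ((2 * pi) ^ DIM('a))"
proof -
  have i: "integrable lborel (\<lambda>x. 2 * pi * normal_density 0 (1 / s) x)"
    using assms by auto
  have g: "gaussian_transform s = (\<lambda>t :: 'a. \<Prod>b\<in>Basis. 2 * pi * normal_density 0 (1 / s) (t \<bullet> b))"
    by (simp add: gaussian_transform_def fun_eq_iff)
  have "integrable lborel (gaussian_transform s :: 'a \<Rightarrow> real)"
    unfolding g using i by (intro lborel_integral_prod(1))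
  moreover have "integral\<^sup>L lborel (gaussian_transform s :: 'a \<Rightarrow> real) = (2 * pi) ^ DIM('a)"
    unfolding g by (subst lborel_integral_prod(2)[OF i]) (use assms in auto)
  ultimately show ?thesis
    by (subst nn_integral_eq_integral) (auto simp: gaussian_nonneg)
qed

text \<open>
  With the weight inserted, the square of the \<open>L\<^sup>2\<close> norm of the transform is a double integral of
  \<open>f y * cnj (f z)\<close> against the positive kernel \<open>gaussian_transform s (y - z)\<close>, to which Schur's test
  applies.
\<close>

lemma fourier_gaussian_weight_le:
  fixes f :: "'a::euclidean_space \<Rightarrow> complex"
  assumes f: "integrable lborel f" and s: "s > 0"
  shows "(\<integral>\<^sup>+ \<xi>. ennreal (gaussian s \<xi> * (norm (fourier f \<xi>))\<^sup>2) \<partial>lborel)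
    \<le> ennreal ((2 * pi) ^ DIM('a)) * (\<integral>\<^sup>+ y. ennreal ((norm (f y))\<^sup>2) \<partial>lborel)"
proof -
  have [measurable]: "f \<in> borel_measurable borel" using f by auto
  define L where "L = (LINT y|lborel. norm (f y))"
  have L: "norm (fourier f \<xi>) \<le> L" "0 \<le> L" for \<xi>
    unfolding L_def by (rule norm_fourier_le) auto
  note [simp] = gaussian_nonneg
  have iW: "integrable lborel (\<lambda>\<xi>. L * gaussian s (\<xi>::'a))" "integrable lborel (gaussian s :: 'a \<Rightarrow> real)"
    using integrable_gaussian[OF s] by auto
  have iW2: "integrable lborel (\<lambda>\<xi>::'a. L\<^sup>2 * gaussian s \<xi>)"
    using integrable_gaussian[OF s] by auto
  have if': "integrable lborel (\<lambda>y. norm (f y))" using f by auto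
  have int: "integrable lborel (\<lambda>\<xi>. gaussian s \<xi> * (norm (fourier f \<xi>))\<^sup>2)"
    by (rule Bochner_Integration.integrable_bound[OF iW2])
       (auto simp: abs_mult mult.commute[of "L\<^sup>2"] intro!: AE_I2 mult_left_mono power_mono L)
  have inner: "(LINT \<xi>|lborel. cis (y \<bullet> \<xi>) * (gaussian s \<xi> * cnj (fourier f \<xi>))) =
      (LINT z|lborel. gaussian_transform s (y - z) * cnj (f z))" for y
  proof -
    have "cis (y \<bullet> \<xi>) * (gaussian s \<xi> * cnj (fourier f \<xi>)) =
      (LINT z|lborel. cis ((y - z) \<bullet> \<xi>) * gaussian s \<xi> * cnj (f z))" for \<xi>
    proof -
      have "cis ((y - z) \<bullet> \<xi>) = cis (y \<bullet> \<xi>) * cnj (cis (\<xi> \<bullet> z))" for z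
        by (simp add: inner_diff_left cis_cnj cis_mult inner_commute[of \<xi>])
      then have "(LINT z|lborel. cis ((y - z) \<bullet> \<xi>) * gaussian s \<xi> * cnj (f z)) =
         (LINT z|lborel. (cis (y \<bullet> \<xi>) * gaussian s \<xi>) * cnj (cis (\<xi> \<bullet> z) * f z))"
        by (simp add: mult_ac)
      also have "\<dots> = (cis (y \<bullet> \<xi>) * gaussian s \<xi>) * cnj (fourier f \<xi>)"
        unfolding fourier_def by (simp only: integral_mult_right_zero Bochner_Integration.integral_cnj)
      finally show ?thesis by (simp add: mult_ac)
    qed
    then have "(LINT \<xi>|lborel. cis (y \<bullet> \<xi>) * (gaussian s \<xi> * cnj (fourier f \<xi>))) =
      (LINT \<xi>|lborel. LINT z|lborel. cis ((y - z) \<bullet> \<xi>) * gaussian s \<xi> * cnj (f z))"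
      by simp
    also have "\<dots> = (LINT z|lborel. LINT \<xi>|lborel. cis ((y - z) \<bullet> \<xi>) * gaussian s \<xi> * cnj (f z))"
      by (rule Fubini_dominated(1)[OF _ iW(2) if']) (measurable, auto simp: norm_mult)
    also have "\<dots> = (LINT z|lborel. fourier (\<lambda>\<xi>. complex_of_real (gaussian s \<xi>)) (y - z) * cnj (f z))"
      unfolding fourier_def by simp
    finally show ?thesis unfolding fourier_gaussian[OF s] .
  qed
  have "complex_of_real (LINT \<xi>|lborel. gaussian s \<xi> * (norm (fourier f \<xi>))\<^sup>2) =
     (LINT \<xi>|lborel. complex_of_real (gaussian s \<xi> * (norm (fourier f \<xi>))\<^sup>2))"
    by (rule integral_complex_of_real[symmetric])
  also have "\<dots> = (LINT \<xi>|lborel. LINT y|lborel. cis (\<xi> \<bullet> y) * f y * (gaussian s \<xi> * cnj (fourier f \<xi>)))"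
  proof (rule Bochner_Integration.integral_cong[OF refl])
    fix \<xi>
    have "complex_of_real (gaussian s \<xi> * (norm (fourier f \<xi>))\<^sup>2) = fourier f \<xi> * (gaussian s \<xi> * cnj (fourier f \<xi>))"
      by (simp add: complex_norm_square mult_ac flip: of_real_power)
    then show "complex_of_real (gaussian s \<xi> * (norm (fourier f \<xi>))\<^sup>2) =
      (LINT y|lborel. cis (\<xi> \<bullet> y) * f y * (gaussian s \<xi> * cnj (fourier f \<xi>)))"
      by (simp add: fourier_def)
  qed
  also have "\<dots> = (LINT y|lborel. LINT \<xi>|lborel. cis (\<xi> \<bullet> y) * f y * (gaussian s \<xi> * cnj (fourier f \<xi>)))"
  proof (rule Fubini_dominated(1)[OF _ iW(1) if'])
    fix \<xi> y
    have "norm (cis (\<xi> \<bullet> y) * f y * (gaussian s \<xi> * cnj (fourier f \<xi>))) =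
        norm (fourier f \<xi>) * (gaussian s \<xi> * norm (f y))"
      by (simp add: norm_mult)
    also have "\<dots> \<le> L * (gaussian s \<xi> * norm (f y))"
      by (intro mult_right_mono L) auto
    finally show "norm (cis (\<xi> \<bullet> y) * f y * (gaussian s \<xi> * cnj (fourier f \<xi>))) \<le> L * gaussian s \<xi> * norm (f y)"
      by (simp add: mult.assoc)
  qed measurable
  also have "\<dots> = (LINT y|lborel. f y * (LINT z|lborel. gaussian_transform s (y - z) * cnj (f z)))"
    unfolding inner[symmetric] integral_mult_right_zero[symmetric]
    by (intro Bochner_Integration.integral_cong refl) (simp add: mult_ac inner_commute)
  finally have eq: "complex_of_real (LINT \<xi>|lborel. gaussian s \<xi> * (norm (fourier f \<xi>))\<^sup>2) = \<dots>" .
  let ?G = "gaussian_transform s :: 'a \<Rightarrow> real"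
  let ?n = "\<integral>\<^sup>+ y. ennreal ((norm (f y))\<^sup>2) \<partial>lborel"
  have "(\<integral>\<^sup>+ \<xi>. ennreal (gaussian s \<xi> * (norm (fourier f \<xi>))\<^sup>2) \<partial>lborel) =
     ennreal (LINT \<xi>|lborel. gaussian s \<xi> * (norm (fourier f \<xi>))\<^sup>2)"
    by (rule nn_integral_eq_integral[OF int]) auto
  also have "\<dots> = ennreal (norm (complex_of_real (LINT \<xi>|lborel. gaussian s \<xi> * (norm (fourier f \<xi>))\<^sup>2)))"
    by (simp add: integral_nonneg)
  also have "\<dots> \<le> (\<integral>\<^sup>+ y. ennreal (norm (f y * (LINT z|lborel. ?G (y - z) * cnj (f z)))) \<partial>lborel)"
    unfolding eq by (rule norm_integral_le_nn_integral)
  also have "\<dots> \<le> (\<integral>\<^sup>+ y. (\<integral>\<^sup>+ z. ennreal (norm (f y) * (?G (y - z) * norm (f z))) \<partial>lborel) \<partial>lborel)"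
  proof (rule nn_integral_mono)
    fix y
    have "ennreal (norm (f y * (LINT z|lborel. ?G (y - z) * cnj (f z)))) =
      ennreal (norm (f y)) * ennreal (norm (LINT z|lborel. ?G (y - z) * cnj (f z)))"
      by (simp add: norm_mult ennreal_mult)
    also have "\<dots> \<le> ennreal (norm (f y)) * (\<integral>\<^sup>+ z. ennreal (norm (?G (y - z) * cnj (f z))) \<partial>lborel)"
      by (intro mult_left_mono norm_integral_le_nn_integral) simp
    also have "\<dots> = (\<integral>\<^sup>+ z. ennreal (norm (f y) * (?G (y - z) * norm (f z))) \<partial>lborel)"
      by (subst nn_integral_cmult[symmetric]) (auto simp: norm_mult ennreal_mult)
    finally show "ennreal (norm (f y * (LINT z|lborel. ?G (y - z) * cnj (f z)))) \<le> \<dots>" .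
  qed
  also have "\<dots> \<le> (\<integral>\<^sup>+ y. (\<integral>\<^sup>+ z. ennreal ((norm (f y))\<^sup>2 / 2) * ennreal (?G (y - z)) +
       ennreal ((norm (f z))\<^sup>2 / 2) * ennreal (?G (y - z)) \<partial>lborel) \<partial>lborel)"
  proof (intro nn_integral_mono)
    fix y z
    have "norm (f y) * norm (f z) \<le> (norm (f y))\<^sup>2 / 2 + (norm (f z))\<^sup>2 / 2"
      using sum_squares_bound[of "norm (f y)" "norm (f z)"] by simp
    then have "(norm (f y) * norm (f z)) * ?G (y - z) \<le> ((norm (f y))\<^sup>2 / 2 + (norm (f z))\<^sup>2 / 2) * ?G (y - z)"
      by (intro mult_right_mono) auto
    then show "ennreal (norm (f y) * (?G (y - z) * norm (f z))) \<le>
      ennreal ((norm (f y))\<^sup>2 / 2) * ennreal (?G (y - z)) + ennreal ((norm (f z))\<^sup>2 / 2) * ennreal (?G (y - z))"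
      by (simp add: mult_ac distrib_left flip: ennreal_mult ennreal_plus)
  qed
  also have "\<dots> = (\<integral>\<^sup>+ y. (\<integral>\<^sup>+ z. ennreal ((norm (f y))\<^sup>2 / 2) * ennreal (?G (y - z)) \<partial>lborel) \<partial>lborel)
     + (\<integral>\<^sup>+ y. (\<integral>\<^sup>+ z. ennreal ((norm (f z))\<^sup>2 / 2) * ennreal (?G (y - z)) \<partial>lborel) \<partial>lborel)"
    by (simp add: nn_integral_add)
  also have "(\<integral>\<^sup>+ y. (\<integral>\<^sup>+ z. ennreal ((norm (f z))\<^sup>2 / 2) * ennreal (?G (y - z)) \<partial>lborel) \<partial>lborel)
     = (\<integral>\<^sup>+ z. (\<integral>\<^sup>+ y. ennreal ((norm (f z))\<^sup>2 / 2) * ennreal (?G (y - z)) \<partial>lborel) \<partial>lborel)"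
    by (rule lborel_pair.Fubini') measurable
  also have "\<dots> = ?n / 2 * ennreal ((2 * pi) ^ DIM('a))"
    by (simp add: nn_integral_cmult nn_integral_multc nn_integral_lborel_translate[of "\<lambda>x. ennreal (?G x)"]
        nn_integral_gaussian_transform[OF s] divide_ennreal[symmetric] nn_integral_divide)
  also have "(\<integral>\<^sup>+ y. (\<integral>\<^sup>+ z. ennreal ((norm (f y))\<^sup>2 / 2) * ennreal (?G (y - z)) \<partial>lborel) \<partial>lborel)
     = ?n / 2 * ennreal ((2 * pi) ^ DIM('a))"
    by (simp add: nn_integral_cmult nn_integral_multc nn_integral_lborel_reflect[of "\<lambda>x. ennreal (?G x)"]
        nn_integral_gaussian_transform[OF s] divide_ennreal[symmetric] nn_integral_divide)
  also have "?n / 2 * ennreal ((2 * pi) ^ DIM('a)) + ?n / 2 * ennreal ((2 * pi) ^ DIM('a)) =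
     ennreal ((2 * pi) ^ DIM('a)) * ?n"
    unfolding mult_2[symmetric] mult.assoc[symmetric] ennreal_times_divide
    by (subst mult.commute[of 2], subst mult_divide_eq_ennreal) (auto simp: mult.commute)
  finally show ?thesis .
qed

text \<open>
  Only the inequality is needed, and it follows by Fatou's lemma as the weight tends to 1. The right
  hand side may be infinite.
\<close>

lemma Plancherel_le:
  fixes f :: "'a::euclidean_space \<Rightarrow> complex"
  assumes f: "integrable lborel f"
  shows "(\<integral>\<^sup>+ \<xi>. ennreal ((norm (fourier f \<xi>))\<^sup>2) \<partial>lborel)
    \<le> ennreal ((2 * pi) ^ DIM('a)) * (\<integral>\<^sup>+ y. ennreal ((norm (f y))\<^sup>2) \<partial>lborel)"
proof -
  have [measurable]: "f \<in> borel_measurable borel" using f by auto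
  let ?h = "\<lambda>n \<xi>. ennreal (gaussian (Suc n) \<xi> * (norm (fourier f \<xi>))\<^sup>2)"
  have lim: "(\<lambda>n. ?h n \<xi>) \<longlonglongrightarrow> ennreal ((norm (fourier f \<xi>))\<^sup>2)" for \<xi>
  proof -
    have "(\<lambda>n. exp (- t\<^sup>2 / (2 * (real (Suc n))\<^sup>2))) \<longlonglongrightarrow> exp 0" for t :: real
      by (intro tendsto_exp) real_asymp
    then have "(\<lambda>n. gaussian (Suc n) \<xi>) \<longlonglongrightarrow> (\<Prod>b\<in>(Basis :: 'a set). 1)"
      unfolding gaussian_def by (intro tendsto_prod) simp
    then have "(\<lambda>n. gaussian (Suc n) \<xi> * (norm (fourier f \<xi>))\<^sup>2) \<longlonglongrightarrow> 1 * (norm (fourier f \<xi>))\<^sup>2"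
      by (intro tendsto_mult) auto
    then show ?thesis by (intro tendsto_ennrealI) simp
  qed
  have "(\<integral>\<^sup>+ \<xi>. ennreal ((norm (fourier f \<xi>))\<^sup>2) \<partial>lborel) = (\<integral>\<^sup>+ \<xi>. liminf (\<lambda>n. ?h n \<xi>) \<partial>lborel)"
    using lim by (intro nn_integral_cong) (simp add: lim_imp_Liminf[symmetric])
  also have "\<dots> \<le> liminf (\<lambda>n. \<integral>\<^sup>+ \<xi>. ?h n \<xi> \<partial>lborel)"
    by (rule nn_integral_liminf) measurable
  also have "\<dots> \<le> ennreal ((2 * pi) ^ DIM('a)) * (\<integral>\<^sup>+ y. ennreal ((norm (f y))\<^sup>2) \<partial>lborel)"
    by (intro Liminf_le always_eventually allI fourier_gaussian_weight_le f) auto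
  finally show ?thesis .
qed

section \<open>Exponential averages and the resolvent kernel\<close>

lemma exponential_density_le: "m > 0 \<Longrightarrow> exponential_density m r \<le> m"
  by (auto simp: exponential_density_def mult_le_cancel_left1)

lemma exponential_density_integral:
  assumes "m > 0"
  shows "(\<integral>\<^sup>+ r. ennreal (exponential_density m r) \<partial>lborel) = 1"
    and "integrable lborel (exponential_density m)"
    and "integral\<^sup>L lborel (exponential_density m) = 1"
proof -
  interpret prob_space "density lborel (exponential_density m)"
    by (rule prob_space_exponential_density[OF assms])
  show 1: "(\<integral>\<^sup>+ r. ennreal (exponential_density m r) \<partial>lborel) = 1"
    using emeasure_space_1 by (simp add: emeasure_density)
  show 2: "integrable lborel (exponential_density m)"
    using assms 1 by (intro integrableI_nonneg) (auto simp: exponential_density_nonneg)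
  have "ennreal (integral\<^sup>L lborel (exponential_density m)) = 1"
    using nn_integral_eq_integral[OF 2] 1 assms by (simp add: exponential_density_nonneg)
  then show "integral\<^sup>L lborel (exponential_density m) = 1"
    by (metis assms ennreal_eq_1)
qed

text \<open>
  For \<open>a = x - s\<close> and \<open>b = x - t\<close>, the product of two translates of the density is bounded by an integrable
  function of \<open>s - t\<close>, uniformly in \<open>x\<close>.
\<close>

lemma exponential_density_decouple:
  assumes m: "m > 0"
  shows "exponential_density m a * exponential_density m b \<le>
    m * (exponential_density m (b - a) + exponential_density m (a - b))"
proof -
  have *: "exponential_density m a * exponential_density m b \<le> m * exponential_density m (b - a)"
    if "a \<le> b" for a b
  proof -
    have "exponential_density m b \<le> exponential_density m (b - a)" if "0 \<le> a"
      using that \<open>a \<le> b\<close> m by (auto simp: exponential_density_def algebra_simps)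
    then have "exponential_density m a * exponential_density m b \<le> m * exponential_density m (b - a)"
      if "0 \<le> a" using that m
      by (intro mult_mono exponential_density_le exponential_density_nonneg) auto
    moreover have "exponential_density m a = 0" if "\<not> 0 \<le> a"
      using that by (simp add: exponential_density_def)
    ultimately show ?thesis
      using m exponential_density_nonneg[OF m, of "b - a"] by (cases "0 \<le> a") auto
  qed
  have nn: "0 \<le> m * exponential_density m c" for c
    using m by (simp add: exponential_density_nonneg)
  show ?thesis
    using *[of a b] *[of b a] nn[of "b - a"] nn[of "a - b"]
    by (cases "a \<le> b") (auto simp: distrib_left mult.commute)
qed

text \<open>
  A bounded function is recovered from \<open>f + f' / m\<close> by averaging over its past: the integrand is
  \<open>- d/dr (exp (- m r) f (x - r))\<close> for positive \<open>r\<close>.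
\<close>

lemma exponential_average:
  fixes f f' :: "real \<Rightarrow> 'b::euclidean_space"
  assumes m: "m > 0"
    and f: "\<And>x. (f has_vector_derivative f' x) (at x)"
    and f': "continuous_on UNIV f'"
    and bnd: "\<And>x. norm (f x) \<le> K" "\<And>x. norm (f' x) \<le> K'"
  shows "f x = (LINT r|lborel. exponential_density m r *\<^sub>R (f (x - r) + (1 / m) *\<^sub>R f' (x - r)))"
proof -
  define g where "g y = f y + (1 / m) *\<^sub>R f' y" for y
  have cf: "continuous_on UNIV f"
    by (intro continuous_at_imp_continuous_on ballI has_vector_derivative_continuous[OF f])
  have cg: "continuous_on UNIV g"
    unfolding g_def by (intro continuous_intros cf f')
  have [measurable]: "g \<in> borel_measurable borel"
    using cg by (rule borel_measurable_continuous_onI)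
  have gb: "norm (g y) \<le> K + K' / m" for y
    unfolding g_def using bnd(1)[of y] bnd(2)[of y] m
    by (intro order_trans[OF norm_triangle_ineq] add_mono) (auto simp: divide_right_mono)
  let ?F = "\<lambda>r. - (exp (- m * r) *\<^sub>R f (x - r))"
  let ?h = "\<lambda>r. (m * exp (- m * r)) *\<^sub>R g (x - r)"
  have dF: "(?F has_vector_derivative ?h r) (at r)" for r
  proof -
    have 1: "((\<lambda>r. f (x - r)) has_vector_derivative (-1) *\<^sub>R f' (x - r)) (at r)"
      by (rule vector_diff_chain_at[of "\<lambda>r. x - r" "-1" r f, unfolded o_def])
        (rule derivative_eq_intros refl | simp | rule f)+
    have 2: "((\<lambda>r. exp (- m * r)) has_field_derivative (- m * exp (- m * r))) (at r)"
      by (auto intro!: derivative_eq_intros)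
    have "(?F has_vector_derivative - (exp (- m * r) *\<^sub>R ((-1) *\<^sub>R f' (x - r)) + (- m * exp (- m * r)) *\<^sub>R f (x - r))) (at r)"
      by (intro has_vector_derivative_minus has_vector_derivative_scaleR 1 2)
    also have "- (exp (- m * r) *\<^sub>R ((-1) *\<^sub>R f' (x - r)) + (- m * exp (- m * r)) *\<^sub>R f (x - r)) = ?h r"
      using m by (simp add: g_def scaleR_add_right)
    finally show ?thesis .
  qed
  have dom: "integrable lborel (\<lambda>r. exponential_density m r *\<^sub>R g (x - r))"
  proof (rule Bochner_Integration.integrable_bound)
    show "integrable lborel (\<lambda>r. exponential_density m r * (K + K' / m))"
      by (intro integrable_mult_left exponential_density_integral m)
    show "AE r in lborel. norm (exponential_density m r *\<^sub>R g (x - r)) \<le> norm (exponential_density m r * (K + K' / m))"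
    proof (rule AE_I2)
      fix r
      have "norm (exponential_density m r *\<^sub>R g (x - r)) = exponential_density m r * norm (g (x - r))"
        using m by (simp add: exponential_density_nonneg)
      also have "\<dots> \<le> exponential_density m r * (K + K' / m)"
        using m gb by (intro mult_left_mono) (auto simp: exponential_density_nonneg)
      also have "\<dots> \<le> norm (exponential_density m r * (K + K' / m))"
        by (simp only: real_norm_def abs_ge_self)
      finally show "norm (exponential_density m r *\<^sub>R g (x - r)) \<le> norm (exponential_density m r * (K + K' / m))" .
    qed
  qed measurable
  have eqind: "indicator {0<..} r *\<^sub>R ?h r = indicator {0<..} r *\<^sub>R (exponential_density m r *\<^sub>R g (x - r))" for r
    by (auto simp: indicator_def exponential_density_def mult.commute)
  have si: "set_integrable lborel {0<..} ?h"
    unfolding set_integrable_def eqind using dom by (rule integrable_mult_indicator[rotated]) auto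
  have B: "(?F \<longlongrightarrow> 0) at_top"
  proof (rule Lim_null_comparison)
    show "\<forall>\<^sub>F r in at_top. norm (?F r) \<le> exp (- m * r) * K"
      using bnd(1) by (intro always_eventually allI) (auto intro!: mult_left_mono)
    show "((\<lambda>r. exp (- m * r) * K) \<longlongrightarrow> 0) at_top"
      using m by (intro tendsto_mult_left_zero) real_asymp
  qed
  have A: "(?F \<longlongrightarrow> - f x) (at_right 0)"
  proof -
    have "isCont ?F 0" using dF[of 0] by (rule has_vector_derivative_continuous)
    then have "(?F \<longlongrightarrow> ?F 0) (at 0)" unfolding isCont_def .
    then have "(?F \<longlongrightarrow> ?F 0) (at_right 0)" by (rule Lim_at_imp_Lim_at_within)
    then show ?thesis by simp
  qed
  have "(LBINT r=0..\<infinity>. ?h r) = 0 - (- f x)"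
  proof (rule interval_integral_FTC_integrable)
    have "continuous_on UNIV ?h"
      by (intro continuous_intros continuous_on_compose2[OF cg]) auto
    then show "isCont ?h r" for r
      by (simp add: continuous_on_eq_continuous_at)
    show "((?F \<circ> real_of_ereal) \<longlongrightarrow> - f x) (at_right 0)" "((?F \<circ> real_of_ereal) \<longlongrightarrow> 0) (at_left \<infinity>)"
      using A B by (simp_all add: zero_ereal_def ereal_tendsto_simps)
    have "einterval 0 \<infinity> = {0<..}" by (auto simp: einterval_def)
    then show "set_integrable lborel (einterval 0 \<infinity>) ?h" using si by simp
    show "(?F has_vector_derivative ?h r) (at r)" for r by (rule dF)
  qed simp
  then have "f x = (LINT r|lborel. indicator {0<..} r *\<^sub>R (exponential_density m r *\<^sub>R g (x - r)))"
    unfolding interval_lebesgue_integral_0_infty set_lebesgue_integral_def eqind by simp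
  also have "\<dots> = (LINT r|lborel. exponential_density m r *\<^sub>R g (x - r))"
  proof (rule integral_cong_AE)
    show "AE r in lborel. indicator {0<..} r *\<^sub>R (exponential_density m r *\<^sub>R g (x - r)) = exponential_density m r *\<^sub>R g (x - r)"
      using AE_lborel_singleton[of 0]
      by eventually_elim (auto simp: indicator_def exponential_density_def)
  qed measurable
  finally show ?thesis unfolding g_def .
qed

text \<open>
  The exponential probability density with rate \<open>m\<close> in each coordinate, for positive
  \<open>m\<close>; it is the fundamental solution of the product of the operators \<open>1 + (1 / m) \<partial>\<^sub>b\<close>.
\<close>

definition exp_kernel :: "real \<Rightarrow> 'a::euclidean_space \<Rightarrow> real"
  where "exp_kernel m x = (\<Prod>b\<in>Basis. exponential_density m (x \<bullet> b))"

text \<open>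
  The kernel that dominates a product of two translates of \<open>exp_kernel\<close>, see \<open>exp_kernel_decouple\<close>.
\<close>

definition pair_kernel :: "real \<Rightarrow> 'a::euclidean_space \<Rightarrow> real"
  where "pair_kernel m x =
    (\<Prod>b\<in>Basis. m * (exponential_density m (x \<bullet> b) + exponential_density m (- (x \<bullet> b))))"

text \<open>
  The function \<open>1 / (1 + i m z)\<close> of one variable. Its product over the coordinates, \<open>resolvent\<close>, is the
  factor gained by integrating by parts with the operators \<open>1 - m \<partial>\<^sub>b\<close> against \<open>exp (i \<xi> z)\<close>.
\<close>

definition resolvent1 :: "real \<Rightarrow> real \<Rightarrow> complex"
  where "resolvent1 m z = 1 / (1 + \<i> * m * z)"

text \<open>
  The product of \<open>resolvent1\<close> over the coordinates.
\<close>

definition resolvent :: "real \<Rightarrow> 'a::euclidean_space \<Rightarrow> complex"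
  where "resolvent m z = (\<Prod>b\<in>Basis. resolvent1 m (z \<bullet> b))"

text \<open>
  The image of \<open>resolvent1 m\<close> under \<open>1 + (1 / m) d/dz\<close>; the derivative of \<open>resolvent1 m\<close> is
  \<open>- i m\<close> times its square.
\<close>

definition resolvent_source1 :: "real \<Rightarrow> real \<Rightarrow> complex"
  where "resolvent_source1 m z = resolvent1 m z - \<i> * (resolvent1 m z)\<^sup>2"

text \<open>
  The product of \<open>resolvent_source1\<close> over the coordinates. It is square integrable, and \<open>resolvent m\<close>
  is its average against \<open>exp_kernel m\<close>.
\<close>

definition resolvent_source :: "real \<Rightarrow> 'a::euclidean_space \<Rightarrow> complex"
  where "resolvent_source m z = (\<Prod>b\<in>Basis. resolvent_source1 m (z \<bullet> b))"

lemma measurable_kernels[measurable]: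
  "exp_kernel m \<in> borel_measurable borel" "pair_kernel m \<in> borel_measurable borel"
  "resolvent1 m \<in> borel_measurable borel" "resolvent m \<in> borel_measurable borel"
  "resolvent_source1 m \<in> borel_measurable borel" "resolvent_source m \<in> borel_measurable borel"
proof -
  show "exp_kernel m \<in> borel_measurable borel" "pair_kernel m \<in> borel_measurable borel"
    unfolding exp_kernel_def[abs_def] pair_kernel_def[abs_def] by measurable
  show [measurable]: "resolvent1 m \<in> borel_measurable borel" unfolding resolvent1_def[abs_def] by measurable
  show [measurable]: "resolvent_source1 m \<in> borel_measurable borel" unfolding resolvent_source1_def[abs_def] by measurable
  show "resolvent m \<in> borel_measurable borel" "resolvent_source m \<in> borel_measurable borel"
    unfolding resolvent_def[abs_def] resolvent_source_def[abs_def] by measurable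
qed

lemma exp_kernel_nonneg: "m > 0 \<Longrightarrow> 0 \<le> exp_kernel m x"
  and pair_kernel_nonneg: "m > 0 \<Longrightarrow> 0 \<le> pair_kernel m x"
  unfolding exp_kernel_def pair_kernel_def
  by (auto intro!: prod_nonneg mult_nonneg_nonneg add_nonneg_nonneg simp: exponential_density_nonneg)

lemma exp_kernel_integral:
  assumes "m > 0"
  shows "integrable lborel (exp_kernel m :: 'a::euclidean_space \<Rightarrow> real)"
    and "(\<integral>\<^sup>+ x. ennreal (exp_kernel m (x :: 'a)) \<partial>lborel) = 1"
proof -
  have g: "exp_kernel m = (\<lambda>x :: 'a. \<Prod>b\<in>Basis. exponential_density m (x \<bullet> b))"
    by (simp add: exp_kernel_def fun_eq_iff)
  note i = exponential_density_integral(2)[OF assms]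
  show 1: "integrable lborel (exp_kernel m :: 'a \<Rightarrow> real)"
    unfolding g by (intro lborel_integral_prod(1) i)
  have "integral\<^sup>L lborel (exp_kernel m :: 'a \<Rightarrow> real) = 1"
    unfolding g by (subst lborel_integral_prod(2)[OF i]) (simp add: exponential_density_integral(3)[OF assms])
  then show "(\<integral>\<^sup>+ x. ennreal (exp_kernel m (x :: 'a)) \<partial>lborel) = 1"
    by (subst nn_integral_eq_integral[OF 1]) (auto simp: exp_kernel_nonneg assms)
qed

lemma nn_integral_pair_kernel:
  assumes m: "m > 0"
  shows "(\<integral>\<^sup>+ x. ennreal (pair_kernel m (x :: 'a::euclidean_space)) \<partial>lborel) = ennreal ((2 * m) ^ DIM('a))"
proof -
  have [simp]: "0 \<le> exponential_density m r" for r using m by (rule exponential_density_nonneg)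
  have 1: "(\<integral>\<^sup>+ r. ennreal (m * (exponential_density m r + exponential_density m (- r))) \<partial>lborel) = ennreal (2 * m)"
  proof -
    have "(\<integral>\<^sup>+ r. ennreal (m * (exponential_density m r + exponential_density m (- r))) \<partial>lborel) =
      ennreal m * ((\<integral>\<^sup>+ r. ennreal (exponential_density m r) \<partial>lborel) + (\<integral>\<^sup>+ r. ennreal (exponential_density m (0 - r)) \<partial>lborel))"
      using m by (subst nn_integral_add[symmetric], simp, simp, subst nn_integral_cmult[symmetric])
        (auto simp: ennreal_mult simp flip: ennreal_plus)
    also have "(\<integral>\<^sup>+ r. ennreal (exponential_density m (0 - r)) \<partial>lborel) = 1"
      by (subst nn_integral_lborel_reflect) (auto simp: exponential_density_integral(1)[OF m])
    finally show ?thesis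
      using m exponential_density_integral(1)[OF m] by (simp add: ennreal_mult mult.commute)
  qed
  have "(\<integral>\<^sup>+ x. ennreal (pair_kernel m (x :: 'a)) \<partial>lborel) =
    (\<integral>\<^sup>+ x. (\<Prod>b\<in>(Basis::'a set). ennreal (m * (exponential_density m (x \<bullet> b) + exponential_density m (- (x \<bullet> b))))) \<partial>lborel)"
    using m unfolding pair_kernel_def by (subst prod_ennreal) (auto intro!: mult_nonneg_nonneg add_nonneg_nonneg)
  also have "\<dots> = ennreal ((2 * m) ^ DIM('a))"
    using m by (subst nn_integral_lborel_prod) (auto simp: 1 ennreal_power)
  finally show ?thesis .
qed

lemma exp_kernel_decouple:
  assumes "m > 0"
  shows "exp_kernel m (x - t) * exp_kernel m (x - s) \<le> pair_kernel m (t - s)"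
  unfolding exp_kernel_def pair_kernel_def prod.distrib[symmetric]
proof (rule prod_mono)
  fix b
  have [simp]: "0 \<le> exponential_density m r" for r using assms by (rule exponential_density_nonneg)
  show "0 \<le> exponential_density m ((x - t) \<bullet> b) * exponential_density m ((x - s) \<bullet> b) \<and>
    exponential_density m ((x - t) \<bullet> b) * exponential_density m ((x - s) \<bullet> b) \<le>
     m * (exponential_density m ((t - s) \<bullet> b) + exponential_density m (- ((t - s) \<bullet> b)))"
    using exponential_density_decouple[OF assms, of "(x - t) \<bullet> b" "(x - s) \<bullet> b"]
    by (simp add: inner_diff_left)
qed

lemma resolvent1_denom_nz: "1 + \<i> * complex_of_real c \<noteq> 0"
  by (simp add: complex_eq_iff)

lemma norm_resolvent1: "(norm (resolvent1 m z))\<^sup>2 = 1 / (1 + (m * z)\<^sup>2)"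
  unfolding resolvent1_def norm_divide power_divide
  by (simp add: cmod_power2)

lemma norm_resolvent1_le: "norm (resolvent1 m z) \<le> 1"
proof -
  have "(norm (resolvent1 m z))\<^sup>2 \<le> 1\<^sup>2"
    unfolding norm_resolvent1 by (simp add: divide_le_eq add_pos_nonneg)
  then show ?thesis by (rule power2_le_imp_le) simp
qed

lemma norm_resolvent_source1_le:
  "norm (resolvent_source1 m z) \<le> 2 * norm (resolvent1 m z)"
  unfolding resolvent_source1_def
  by (rule order_trans[OF norm_triangle_ineq4])
    (use norm_resolvent1_le[of m z] in \<open>auto simp: norm_mult norm_power power2_eq_square mult_left_le\<close>)

lemma resolvent1_average:
  assumes m: "m > 0"
  shows "integrable lborel (\<lambda>r. complex_of_real (exponential_density m r) * resolvent_source1 m (z - r))"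
    and "(LINT r|lborel. complex_of_real (exponential_density m r) * resolvent_source1 m (z - r)) = resolvent1 m z"
proof -
  have b: "norm (resolvent_source1 m x) \<le> 2" for x
    using norm_resolvent_source1_le[of m x] norm_resolvent1_le[of m x] by linarith
  show "integrable lborel (\<lambda>r. complex_of_real (exponential_density m r) * resolvent_source1 m (z - r))"
    by (rule Bochner_Integration.integrable_bound[OF integrable_mult_left[OF exponential_density_integral(2)[OF m], of 2]])
       (use b m in \<open>auto intro!: AE_I2 mult_mono simp: norm_mult abs_mult exponential_density_nonneg\<close>)
  let ?f' = "\<lambda>x. - (\<i> * m) * (resolvent1 m x)\<^sup>2"
  have cr: "continuous_on UNIV (resolvent1 m)"
    unfolding resolvent1_def[abs_def] using resolvent1_denom_nz[of "m * _"]
    by (intro continuous_intros) (auto simp: mult.assoc)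
  have "resolvent1 m z = (LINT r|lborel. exponential_density m r *\<^sub>R (resolvent1 m (z - r) + (1 / m) *\<^sub>R ?f' (z - r)))"
  proof (rule exponential_average[OF m, where K = 1 and K' = m])
    fix x :: real
    have nz: "1 + \<i> * complex_of_real m * complex_of_real x \<noteq> 0"
      using resolvent1_denom_nz[of "m * x"] by (simp add: mult.assoc)
    have "((\<lambda>w. 1 / (1 + \<i> * m * w)) has_field_derivative ?f' x) (at (of_real x))"
      using nz by (auto intro!: derivative_eq_intros simp: resolvent1_def power2_eq_square)
    then have "((\<lambda>w. 1 / (1 + \<i> * m * w)) \<circ> of_real has_vector_derivative 1 * ?f' x) (at x)"
      by (intro field_vector_diff_chain_at) (auto intro!: derivative_eq_intros has_vector_derivative_of_real)
    then show "(resolvent1 m has_vector_derivative ?f' x) (at x)"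
      by (simp add: o_def resolvent1_def[abs_def])
    show "norm (?f' x) \<le> m"
      using norm_resolvent1_le[of m x] m by (simp add: norm_mult norm_power power_le_one)
  qed (auto intro!: continuous_intros cr norm_resolvent1_le)
  also have "\<dots> = (LINT r|lborel. complex_of_real (exponential_density m r) * resolvent_source1 m (z - r))"
    using m by (simp add: resolvent_source1_def scaleR_conv_of_real)
  finally show "(LINT r|lborel. complex_of_real (exponential_density m r) * resolvent_source1 m (z - r)) = resolvent1 m z"
    by simp
qed

lemma nn_integral_resolvent_source1:
  assumes m: "m > 0"
  shows "(\<integral>\<^sup>+ z. ennreal ((norm (resolvent_source1 m z))\<^sup>2) \<partial>lborel) \<le> ennreal (4 * pi / m)"
proof -
  let ?f = "\<lambda>z::real. 4 / (1 + (m * z)\<^sup>2)"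
  let ?g = "\<lambda>z::real. ennreal (?f z) * indicator {0..} z"
  have pos: "0 < 1 + (m * z)\<^sup>2" for z by (simp add: add_pos_nonneg)
  have half: "integral\<^sup>N lborel ?g = ennreal (2 * pi / m)"
  proof -
    have "integral\<^sup>N lborel ?g = ennreal (2 * pi / m - 4 / m * arctan (m * 0))"
    proof (rule nn_integral_FTC_atLeast)
      show "DERIV (\<lambda>z. 4 / m * arctan (m * z)) z :> ?f z" for z
        using m by (auto intro!: derivative_eq_intros simp: divide_simps)
      have "((\<lambda>z. 4 / m * arctan (m * z)) \<longlongrightarrow> 4 / m * (pi / 2)) at_top"
        using m by (intro tendsto_intros filterlim_compose[OF tendsto_arctan_at_top]) real_asymp
      then show "((\<lambda>z. 4 / m * arctan (m * z)) \<longlongrightarrow> 2 * pi / m) at_top" by simp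
    qed (use pos in \<open>auto simp: less_imp_le\<close>)
    then show ?thesis by simp
  qed
  have "(\<integral>\<^sup>+ z. ennreal ((norm (resolvent_source1 m z))\<^sup>2) \<partial>lborel) \<le> (\<integral>\<^sup>+ z. ?g z + ?g (0 - z) \<partial>lborel)"
  proof (rule nn_integral_mono)
    fix z
    have "(norm (resolvent_source1 m z))\<^sup>2 \<le> (2 * norm (resolvent1 m z))\<^sup>2"
      by (intro power_mono norm_resolvent_source1_le) auto
    also have "\<dots> = ?f z" by (simp add: power_mult_distrib norm_resolvent1)
    finally have "ennreal ((norm (resolvent_source1 m z))\<^sup>2) \<le> ennreal (?f z)" by (rule ennreal_leI)
    also have "\<dots> \<le> ?g z + ?g (0 - z)" by (auto simp: indicator_def)
    finally show "ennreal ((norm (resolvent_source1 m z))\<^sup>2) \<le> ?g z + ?g (0 - z)" .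
  qed
  also have "\<dots> = integral\<^sup>N lborel ?g + (\<integral>\<^sup>+ z. ?g (0 - z) \<partial>lborel)"
    by (rule nn_integral_add) measurable
  also have "(\<integral>\<^sup>+ z. ?g (0 - z) \<partial>lborel) = integral\<^sup>N lborel ?g"
    by (rule nn_integral_lborel_reflect) measurable
  finally show ?thesis
    using m unfolding half by (simp flip: ennreal_plus)
qed

lemma norm_resolvent_source_le: "norm (resolvent_source m (z :: 'a::euclidean_space)) \<le> 2 ^ DIM('a)"
proof -
  have b: "norm (resolvent_source1 m x) \<le> 2" for x
    using norm_resolvent_source1_le[of m x] norm_resolvent1_le[of m x] by linarith
  have "norm (resolvent_source m z) = (\<Prod>b\<in>(Basis :: 'a set). norm (resolvent_source1 m (z \<bullet> b)))"
    by (simp add: resolvent_source_def prod_norm)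
  also have "\<dots> \<le> (\<Prod>b\<in>(Basis :: 'a set). 2)" by (intro prod_mono) (auto simp: b)
  finally show ?thesis by simp
qed

lemma nn_integral_resolvent_source:
  assumes m: "m > 0"
  shows "(\<integral>\<^sup>+ z. ennreal ((norm (resolvent_source m (z :: 'a::euclidean_space)))\<^sup>2) \<partial>lborel)
    \<le> ennreal ((4 * pi / m) ^ DIM('a))"
proof -
  have "(\<integral>\<^sup>+ z. ennreal ((norm (resolvent_source m (z :: 'a)))\<^sup>2) \<partial>lborel) =
    (\<integral>\<^sup>+ z. (\<Prod>b\<in>(Basis::'a set). ennreal ((norm (resolvent_source1 m (z \<bullet> b)))\<^sup>2)) \<partial>lborel)"
  proof (intro nn_integral_cong)
    fix z :: 'a
    have "norm (resolvent_source m z) = (\<Prod>b\<in>(Basis::'a set). norm (resolvent_source1 m (z \<bullet> b)))"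
      by (simp add: resolvent_source_def prod_norm)
    then show "ennreal ((norm (resolvent_source m z))\<^sup>2) =
        (\<Prod>b\<in>(Basis::'a set). ennreal ((norm (resolvent_source1 m (z \<bullet> b)))\<^sup>2))"
      by (simp only: prod_power_distrib) (rule prod_ennreal[symmetric], simp)
  qed
  also have "\<dots> = (\<Prod>b\<in>(Basis::'a set). \<integral>\<^sup>+ z. ennreal ((norm (resolvent_source1 m z))\<^sup>2) \<partial>lborel)"
    by (rule nn_integral_lborel_prod) auto
  also have "\<dots> \<le> (\<Prod>b\<in>(Basis::'a set). ennreal (4 * pi / m))"
    by (intro prod_mono_ennreal nn_integral_resolvent_source1[OF m])
  also have "\<dots> = ennreal ((4 * pi / m) ^ DIM('a))"
    using m by (simp add: ennreal_power)
  finally show ?thesis .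
qed

lemma resolvent_average:
  fixes x y :: "'a::euclidean_space"
  assumes m: "m > 0"
  shows "resolvent m (x - y) = (LINT t|lborel. complex_of_real (exp_kernel m (x - t)) * resolvent_source m (t - y))"
proof -
  let ?g = "\<lambda>r. complex_of_real (exp_kernel m r) * resolvent_source m (x - y - r)"
  have "(LINT t|lborel. complex_of_real (exp_kernel m (x - t)) * resolvent_source m (t - y)) = (LINT t|lborel. ?g (x - t))"
    by (simp add: algebra_simps)
  also have "\<dots> = integral\<^sup>L lborel ?g" by (rule lborel_integral_reflect) measurable
  also have "\<dots> = (LINT r|lborel. (\<Prod>b\<in>Basis. complex_of_real (exponential_density m (r \<bullet> b)) * resolvent_source1 m ((x - y) \<bullet> b - r \<bullet> b)))"
    by (simp add: exp_kernel_def resolvent_source_def prod.distrib inner_diff_left)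
  also have "\<dots> = resolvent m (x - y)"
    unfolding resolvent_def by (subst lborel_integral_prod(2)) (auto simp: resolvent1_average[OF m])
  finally show ?thesis by simp
qed

section \<open>The estimate for scalar symbols in terms of a source symbol\<close>

lemma exp_kernel_reflect:
  fixes x :: "'a::euclidean_space"
  assumes m: "m > 0"
  shows "integrable lborel (\<lambda>s. exp_kernel m (x - s))"
    and "(\<integral>\<^sup>+ s. ennreal (exp_kernel m (x - s)) \<partial>lborel) = 1"
    and "(LINT s|lborel. exp_kernel m (x - s)) = 1"
proof -
  show 1: "(\<integral>\<^sup>+ s. ennreal (exp_kernel m (x - s)) \<partial>lborel) = 1"
    by (subst nn_integral_lborel_reflect) (auto simp: exp_kernel_integral(2)[OF m])
  show 2: "integrable lborel (\<lambda>s. exp_kernel m (x - s))"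
    using 1 by (intro integrableI_nonneg) (auto simp: exp_kernel_nonneg m)
  have "ennreal (LINT s|lborel. exp_kernel m (x - s)) = 1"
    using nn_integral_eq_integral[OF 2] 1 m by (simp add: exp_kernel_nonneg)
  then show "(LINT s|lborel. exp_kernel m (x - s)) = 1"
    by (metis ennreal_eq_1)
qed

text \<open>
  The core of the argument. The symbol \<open>\<alpha>\<close> enters only through its inverse Fourier transform in \<open>\<xi>\<close>,
  which is assumed to be the resolvent factor times that of the average of \<open>B\<close> in \<open>x\<close>. The hypothesis
  on the supports makes all integrals absolutely convergent, and neither \<open>A\<close> nor \<open>R\<close> enters the
  bound. Nor does \<open>m\<close>: \<open>pair_kernel\<close> contributes \<open>(2 m)\<^sup>d\<close> and \<open>resolvent_source\<close> contributes
  \<open>(4 \<pi> / m)\<^sup>d\<close>.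
\<close>

lemma nn_integral_localized_quantization_le:
  fixes \<alpha> B :: "'a::euclidean_space \<times> 'a \<Rightarrow> complex" and u :: "'a \<Rightarrow> complex"
  assumes m: "m > 0"
    and \<alpha>_meas[measurable]: "\<alpha> \<in> borel_measurable (borel \<Otimes>\<^sub>M borel)"
    and B_meas[measurable]: "B \<in> borel_measurable (borel \<Otimes>\<^sub>M borel)"
    and \<alpha>: "\<And>x \<xi>. norm (\<alpha> (x, \<xi>)) \<le> A * indicator (cball 0 R) \<xi>"
    and B: "\<And>x \<xi>. norm (B (x, \<xi>)) \<le> M * indicator (cball 0 R) \<xi>"
    and M: "0 \<le> M"
    and factor: "\<And>x z. (LINT \<xi>|lborel. cis (\<xi> \<bullet> z) * \<alpha> (x, \<xi>)) =
       resolvent m z * (LINT \<xi>|lborel. cis (\<xi> \<bullet> z) *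
         (LINT s|lborel. complex_of_real (exp_kernel m (x - s)) * B (s, \<xi>)))"
    and u: "integrable lborel u"
  shows "(\<integral>\<^sup>+ x. ennreal ((norm (LINT \<xi>|lborel. LINT y|lborel.
        cis (\<xi> \<bullet> (x - y)) * (\<alpha> (x, \<xi>) * u y)))\<^sup>2) \<partial>lborel)
     \<le> ennreal ((32 * pi ^ 3) ^ DIM('a) * M\<^sup>2) * (\<integral>\<^sup>+ y. ennreal ((norm (u y))\<^sup>2) \<partial>lborel)"
proof -
  let ?ind = "indicator (cball 0 R) :: 'a \<Rightarrow> real"
  let ?e = "exp_kernel m :: 'a \<Rightarrow> real"
  let ?\<psi> = "resolvent_source m :: 'a \<Rightarrow> complex"
  have [measurable]: "u \<in> borel_measurable borel" using u by auto
  have e0[simp]: "0 \<le> ?e x" for x using m by (rule exp_kernel_nonneg)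
  note e_int = exp_kernel_reflect[OF m]
  have ind_int: "integrable lborel (\<lambda>\<xi>. c * ?ind \<xi>)" for c
    by (intro integrable_mult_right integrable_indicator_cball)
  have u_int: "integrable lborel (\<lambda>y. norm (u y))" using u by auto

  define b where "b x \<xi> = (LINT s|lborel. complex_of_real (?e (x - s)) * B (s, \<xi>))" for x \<xi>
  have [measurable]: "case_prod b \<in> borel_measurable (borel \<Otimes>\<^sub>M borel)"
    unfolding b_def by measurable
  have b_le: "norm (b x \<xi>) \<le> M * ?ind \<xi>" for x \<xi>
  proof -
    have "norm (b x \<xi>) \<le> (LINT s|lborel. ?e (x - s) * (M * ?ind \<xi>))"
      unfolding b_def
      by (rule norm_integral_le_dominated)
        (auto simp: norm_mult intro!: integrable_mult_left e_int mult_left_mono B)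
    then show ?thesis by (simp add: e_int)
  qed
  \<comment> \<open>The kernel of the operator with symbol \<open>b\<close>, so that \<open>\<alpha>\<close> has the kernel \<open>resolvent m (x - y) * k x y\<close>.\<close>
  define k where "k x y = (LINT \<xi>|lborel. cis (\<xi> \<bullet> (x - y)) * b x \<xi>)" for x y
  have [measurable]: "case_prod k \<in> borel_measurable (borel \<Otimes>\<^sub>M borel)"
    unfolding k_def by measurable
  define Kb where "Kb = (LINT \<xi>|lborel. M * ?ind \<xi>)"
  have k_le: "norm (k x y) \<le> Kb" for x y
    unfolding k_def Kb_def using b_le
    by (intro norm_integral_le_dominated ind_int) (auto simp: norm_mult)

  define v where "v t y = ?\<psi> (t - y) * u y" for t y
  have v_meas[measurable]: "case_prod v \<in> borel_measurable (borel \<Otimes>\<^sub>M borel)"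
    unfolding v_def by measurable
  have v_int: "integrable lborel (v t)" for t
    unfolding v_def[abs_def]
  proof (rule Bochner_Integration.integrable_bound[OF integrable_mult_right[OF u_int, of "2 ^ DIM('a)"]])
    show "AE y in lborel. norm (?\<psi> (t - y) * u y) \<le> norm (2 ^ DIM('a) * norm (u y))"
      by (intro AE_I2) (simp add: norm_mult mult_right_mono norm_resolvent_source_le)
  qed measurable
  have nv_int: "integrable lborel (\<lambda>y. norm (v t y))" for t using v_int by auto
  define V where "V t \<xi> = (LINT y|lborel. cis (- (\<xi> \<bullet> y)) * v t y)" for t \<xi>
  have V_fourier: "V t \<xi> = fourier (v t) (0 - \<xi>)" for t \<xi>
    by (simp add: V_def fourier_def)
  have [measurable]: "case_prod V \<in> borel_measurable (borel \<Otimes>\<^sub>M borel)"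
    unfolding V_def by measurable
  define L where "L t = (LINT y|lborel. norm (v t y))" for t
  have V_le: "norm (V t \<xi>) \<le> L t" and L0: "0 \<le> L t" for t \<xi>
    unfolding V_fourier L_def by (rule norm_fourier_le) simp
  \<comment> \<open>In \<open>H s t x\<close> the variable \<open>x\<close> occurs in the exponential only, so that for fixed \<open>s\<close> and \<open>t\<close>
    it is a Fourier transform in \<open>x\<close>.\<close>
  define H where "H s t x = (LINT \<xi>|lborel. cis (\<xi> \<bullet> x) * (B (s, \<xi>) * V t \<xi>))" for s t x
  have H_meas[measurable]: "(\<lambda>(s, t, x). H s t x) \<in> borel_measurable (borel \<Otimes>\<^sub>M borel \<Otimes>\<^sub>M borel)"
    unfolding H_def by measurable
  have [measurable (raw)]: "(\<lambda>w. H (f w) (g w) (h w)) \<in> borel_measurable N"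
    if [measurable]: "f \<in> borel_measurable N" "g \<in> borel_measurable N" "h \<in> borel_measurable N"
    for f g h :: "'x \<Rightarrow> 'a" and N :: "'x measure"
    using measurable_compose[OF _ H_meas, of "\<lambda>w. (f w, g w, h w)" N] by simp
  have BV_le: "norm (B (s, \<xi>) * V t \<xi>) \<le> M * L t * ?ind \<xi>" for s t \<xi>
  proof -
    have "norm (B (s, \<xi>) * V t \<xi>) \<le> (M * ?ind \<xi>) * L t"
      unfolding norm_mult using M by (intro mult_mono B V_le) auto
    then show ?thesis by (simp add: mult_ac)
  qed

  have kv: "(LINT y|lborel. k x y * v t y) = (LINT s|lborel. complex_of_real (?e (x - s)) * H s t x)" for x t
  proof -
    have "(LINT y|lborel. k x y * v t y) =
        (LINT y|lborel. LINT \<xi>|lborel. cis (\<xi> \<bullet> (x - y)) * b x \<xi> * v t y)"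
      by (simp add: k_def)
    also have "\<dots> = (LINT \<xi>|lborel. LINT y|lborel. cis (\<xi> \<bullet> (x - y)) * b x \<xi> * v t y)"
    proof (rule Fubini_dominated(1)[OF _ nv_int ind_int])
      show "norm (cis (\<xi> \<bullet> (x - y)) * b x \<xi> * v t y) \<le> norm (v t y) * (M * ?ind \<xi>)" for y \<xi>
        using mult_right_mono[OF b_le norm_ge_zero, of x \<xi> "v t y"] by (simp add: norm_mult mult_ac)
    qed measurable
    also have "\<dots> = (LINT \<xi>|lborel. cis (\<xi> \<bullet> x) * b x \<xi> * V t \<xi>)"
    proof (rule Bochner_Integration.integral_cong[OF refl])
      fix \<xi>
      have "cis (\<xi> \<bullet> (x - y)) * b x \<xi> * v t y = (cis (\<xi> \<bullet> x) * b x \<xi>) * (cis (- (\<xi> \<bullet> y)) * v t y)" for y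
      proof -
        have "cis (\<xi> \<bullet> (x - y)) = cis (\<xi> \<bullet> x) * cis (- (\<xi> \<bullet> y))"
          by (simp add: inner_diff_right cis_mult)
        then show ?thesis by simp
      qed
      then show "(LINT y|lborel. cis (\<xi> \<bullet> (x - y)) * b x \<xi> * v t y) = cis (\<xi> \<bullet> x) * b x \<xi> * V t \<xi>"
        unfolding V_def by (simp only: integral_mult_right_zero)
    qed
    also have "\<dots> = (LINT \<xi>|lborel. LINT s|lborel. ?e (x - s) * (cis (\<xi> \<bullet> x) * (B (s, \<xi>) * V t \<xi>)))"
    proof (rule Bochner_Integration.integral_cong[OF refl])
      fix \<xi>
      have "(LINT s|lborel. ?e (x - s) * (cis (\<xi> \<bullet> x) * (B (s, \<xi>) * V t \<xi>))) =
        (LINT s|lborel. (cis (\<xi> \<bullet> x) * V t \<xi>) * (?e (x - s) * B (s, \<xi>)))"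
        by (simp add: mult_ac)
      also have "\<dots> = (cis (\<xi> \<bullet> x) * V t \<xi>) * b x \<xi>"
        unfolding b_def by (rule integral_mult_right_zero)
      finally have eq: "(LINT s|lborel. ?e (x - s) * (cis (\<xi> \<bullet> x) * (B (s, \<xi>) * V t \<xi>))) =
        (cis (\<xi> \<bullet> x) * V t \<xi>) * b x \<xi>" .
      show "cis (\<xi> \<bullet> x) * b x \<xi> * V t \<xi> = (LINT s|lborel. ?e (x - s) * (cis (\<xi> \<bullet> x) * (B (s, \<xi>) * V t \<xi>)))"
        unfolding eq by (simp only: mult_ac)
    qed
    also have "\<dots> = (LINT s|lborel. LINT \<xi>|lborel. ?e (x - s) * (cis (\<xi> \<bullet> x) * (B (s, \<xi>) * V t \<xi>)))"
    proof (rule Fubini_dominated(1)[OF _ ind_int e_int(1)])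
      show "norm (?e (x - s) * (cis (\<xi> \<bullet> x) * (B (s, \<xi>) * V t \<xi>))) \<le> (M * L t) * ?ind \<xi> * ?e (x - s)" for \<xi> s
        using mult_left_mono[OF BV_le e0, of "x - s" s \<xi> t] by (simp add: norm_mult mult_ac)
    qed measurable
    finally show ?thesis by (simp add: H_def)
  qed

  let ?I = "\<lambda>x. LINT \<xi>|lborel. LINT y|lborel. cis (\<xi> \<bullet> (x - y)) * (\<alpha> (x, \<xi>) * u y)"
  have I: "?I x = (LINT t|lborel. ?e (x - t) * (LINT s|lborel. ?e (x - s) * H s t x))" for x
  proof -
    have "?I x = (LINT y|lborel. LINT \<xi>|lborel. cis (\<xi> \<bullet> (x - y)) * (\<alpha> (x, \<xi>) * u y))"
    proof (rule Fubini_dominated(1)[OF _ ind_int u_int])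
      show "norm (cis (\<xi> \<bullet> (x - y)) * (\<alpha> (x, \<xi>) * u y)) \<le> A * ?ind \<xi> * norm (u y)" for \<xi> y
        using mult_right_mono[OF \<alpha> norm_ge_zero, of x \<xi> "u y"] by (simp add: norm_mult)
    qed measurable
    also have "\<dots> = (LINT y|lborel. resolvent m (x - y) * k x y * u y)"
      unfolding k_def b_def factor[symmetric] by (simp add: mult.assoc[symmetric])
    also have "\<dots> = (LINT y|lborel. LINT t|lborel. ?e (x - t) * (k x y * v t y))"
    proof (rule Bochner_Integration.integral_cong[OF refl])
      fix y
      have "resolvent m (x - y) * k x y * u y = (LINT t|lborel. (?e (x - t) * ?\<psi> (t - y)) * (k x y * u y))"
        unfolding integral_mult_left_zero resolvent_average[OF m] by (simp only: mult.assoc)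
      then show "resolvent m (x - y) * k x y * u y = (LINT t|lborel. ?e (x - t) * (k x y * v t y))"
        by (simp add: v_def mult_ac)
    qed
    also have "\<dots> = (LINT t|lborel. LINT y|lborel. ?e (x - t) * (k x y * v t y))"
    proof (rule Fubini_dominated(1)[OF _ integrable_mult_right[OF u_int] e_int(1)])
      fix y t
      have "norm (k x y * v t y) \<le> Kb * (2 ^ DIM('a) * norm (u y))"
        unfolding v_def norm_mult
        by (intro mult_mono k_le mult_right_mono norm_resolvent_source_le) (auto simp: Kb_def M)
      from mult_left_mono[OF this e0, of "x - t"]
      show "norm (?e (x - t) * (k x y * v t y)) \<le> (Kb * 2 ^ DIM('a)) * norm (u y) * ?e (x - t)"
        by (simp add: norm_mult mult_ac)
    qed measurable
    finally show ?thesis by (simp add: kv)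
  qed

  let ?n = "\<integral>\<^sup>+ y. ennreal ((norm (u y))\<^sup>2) \<partial>lborel"
  let ?h = "\<lambda>s t x. ennreal ((norm (H s t x))\<^sup>2)"
  let ?\<rho> = "\<lambda>t s. ennreal (pair_kernel m (t - s :: 'a))"
  let ?P = "ennreal ((2 * pi) ^ DIM('a))"
  have I_le: "ennreal ((norm (?I x))\<^sup>2) \<le> (\<integral>\<^sup>+ t. (\<integral>\<^sup>+ s. ?\<rho> t s * ?h s t x \<partial>lborel) \<partial>lborel)" for x
  proof -
    have "ennreal (norm (?I x)) \<le> (\<integral>\<^sup>+ t. ennreal (norm (?e (x - t) * (LINT s|lborel. ?e (x - s) * H s t x))) \<partial>lborel)"
      unfolding I by (rule norm_integral_le_nn_integral)
    also have "\<dots> = (\<integral>\<^sup>+ t. ennreal (?e (x - t)) * ennreal (norm (LINT s|lborel. ?e (x - s) * H s t x)) \<partial>lborel)"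
      by (simp add: norm_mult ennreal_mult)
    also have "\<dots> \<le> (\<integral>\<^sup>+ t. ennreal (?e (x - t)) * (\<integral>\<^sup>+ s. ennreal (norm (?e (x - s) * H s t x)) \<partial>lborel) \<partial>lborel)"
      by (intro nn_integral_mono mult_left_mono norm_integral_le_nn_integral) simp
    finally have 1: "ennreal (norm (?I x)) \<le> (\<integral>\<^sup>+ t. ennreal (?e (x - t)) * (\<integral>\<^sup>+ s. ennreal (?e (x - s)) * ennreal (norm (H s t x)) \<partial>lborel) \<partial>lborel)"
      by (simp add: norm_mult ennreal_mult)
    have "ennreal ((norm (?I x))\<^sup>2) = (ennreal (norm (?I x)))\<^sup>2"
      by (simp add: ennreal_power)
    also have "\<dots> \<le> (\<integral>\<^sup>+ t. ennreal (?e (x - t)) * (\<integral>\<^sup>+ s. ennreal (?e (x - s)) * ennreal (norm (H s t x)) \<partial>lborel) \<partial>lborel)\<^sup>2"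
      by (intro power_mono_ennreal 1)
    also have "\<dots> \<le> (\<integral>\<^sup>+ t. ennreal (?e (x - t)) * (\<integral>\<^sup>+ s. ennreal (?e (x - s)) * ennreal (norm (H s t x)) \<partial>lborel)\<^sup>2 \<partial>lborel)"
      by (rule nn_integral_weighted_square_le) (simp_all add: e_int)
    also have "\<dots> \<le> (\<integral>\<^sup>+ t. ennreal (?e (x - t)) * (\<integral>\<^sup>+ s. ennreal (?e (x - s)) * (ennreal (norm (H s t x)))\<^sup>2 \<partial>lborel) \<partial>lborel)"
      by (intro nn_integral_mono mult_left_mono nn_integral_weighted_square_le) (simp_all add: e_int)
    also have "\<dots> = (\<integral>\<^sup>+ t. (\<integral>\<^sup>+ s. ennreal (?e (x - t) * ?e (x - s)) * ?h s t x \<partial>lborel) \<partial>lborel)"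
      by (subst nn_integral_cmult[symmetric]) (simp_all add: ennreal_mult ennreal_power mult.assoc)
    \<comment> \<open>The weight no longer depends on \<open>x\<close>, so that the integral in \<open>x\<close> can be taken first.\<close>
    also have "\<dots> \<le> (\<integral>\<^sup>+ t. (\<integral>\<^sup>+ s. ?\<rho> t s * ?h s t x \<partial>lborel) \<partial>lborel)"
      by (intro nn_integral_mono mult_right_mono ennreal_leI exp_kernel_decouple m) simp
    finally show ?thesis .
  qed
  have H_le: "(\<integral>\<^sup>+ x. ?h s t x \<partial>lborel) \<le> ?P * (ennreal (M\<^sup>2) * (?P * (\<integral>\<^sup>+ y. ennreal ((norm (v t y))\<^sup>2) \<partial>lborel)))" for s t
  proof -
    have BV_int: "integrable lborel (\<lambda>\<xi>. B (s, \<xi>) * V t \<xi>)"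
    proof (rule Bochner_Integration.integrable_bound[OF ind_int[of "M * L t"]])
      show "AE \<xi> in lborel. norm (B (s, \<xi>) * V t \<xi>) \<le> norm (M * L t * ?ind \<xi>)"
        unfolding real_norm_def by (intro AE_I2 order_trans[OF BV_le abs_ge_self])
    qed measurable
    have "H s t x = fourier (\<lambda>\<xi>. B (s, \<xi>) * V t \<xi>) x" for x
      by (simp add: H_def fourier_def inner_commute)
    then have 1: "(\<integral>\<^sup>+ x. ?h s t x \<partial>lborel) \<le> ?P * (\<integral>\<^sup>+ \<xi>. ennreal ((norm (B (s, \<xi>) * V t \<xi>))\<^sup>2) \<partial>lborel)"
      using Plancherel_le[OF BV_int] by simp
    have "(\<integral>\<^sup>+ \<xi>. ennreal ((norm (B (s, \<xi>) * V t \<xi>))\<^sup>2) \<partial>lborel) \<le>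
        (\<integral>\<^sup>+ \<xi>. ennreal (M\<^sup>2) * ennreal ((norm (V t \<xi>))\<^sup>2) \<partial>lborel)"
    proof (rule nn_integral_mono)
      fix \<xi>
      have "norm (B (s, \<xi>)) \<le> M"
        by (rule order_trans[OF B]) (use M in \<open>simp add: mult_left_le indicator_def\<close>)
      then have "(norm (B (s, \<xi>) * V t \<xi>))\<^sup>2 \<le> M\<^sup>2 * (norm (V t \<xi>))\<^sup>2"
        unfolding norm_mult power_mult_distrib by (intro mult_right_mono power_mono) auto
      then show "ennreal ((norm (B (s, \<xi>) * V t \<xi>))\<^sup>2) \<le> ennreal (M\<^sup>2) * ennreal ((norm (V t \<xi>))\<^sup>2)"
        by (simp add: ennreal_leI flip: ennreal_mult)
    qed
    also have "\<dots> = ennreal (M\<^sup>2) * (\<integral>\<^sup>+ \<xi>. ennreal ((norm (V t \<xi>))\<^sup>2) \<partial>lborel)"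
      by (rule nn_integral_cmult) measurable
    finally have 2: "(\<integral>\<^sup>+ \<xi>. ennreal ((norm (B (s, \<xi>) * V t \<xi>))\<^sup>2) \<partial>lborel) \<le> \<dots>" .
    have "(\<integral>\<^sup>+ \<xi>. ennreal ((norm (V t \<xi>))\<^sup>2) \<partial>lborel) = (\<integral>\<^sup>+ \<xi>. ennreal ((norm (fourier (v t) \<xi>))\<^sup>2) \<partial>lborel)"
      unfolding V_fourier
      by (rule nn_integral_lborel_reflect[of "\<lambda>\<xi>. ennreal ((norm (fourier (v t) \<xi>))\<^sup>2)"]) measurable
    also have "\<dots> \<le> ?P * (\<integral>\<^sup>+ y. ennreal ((norm (v t y))\<^sup>2) \<partial>lborel)"
      by (rule Plancherel_le[OF v_int])
    finally show ?thesis
      by (intro order_trans[OF 1] mult_left_mono order_trans[OF 2]) auto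
  qed
  have v_le: "(\<integral>\<^sup>+ t. (\<integral>\<^sup>+ y. ennreal ((norm (v t y))\<^sup>2) \<partial>lborel) \<partial>lborel) \<le> ennreal ((4 * pi / m) ^ DIM('a)) * ?n"
  proof -
    have "(\<integral>\<^sup>+ t. (\<integral>\<^sup>+ y. ennreal ((norm (v t y))\<^sup>2) \<partial>lborel) \<partial>lborel) =
       (\<integral>\<^sup>+ y. (\<integral>\<^sup>+ t. ennreal ((norm (v t y))\<^sup>2) \<partial>lborel) \<partial>lborel)"
      by (rule lborel_pair.Fubini') measurable
    also have "\<dots> = (\<integral>\<^sup>+ y. (\<integral>\<^sup>+ t. ennreal ((norm (?\<psi> (t - y)))\<^sup>2) * ennreal ((norm (u y))\<^sup>2) \<partial>lborel) \<partial>lborel)"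
      by (simp add: v_def norm_mult power_mult_distrib ennreal_mult)
    also have "\<dots> = (\<integral>\<^sup>+ y. (\<integral>\<^sup>+ t. ennreal ((norm (?\<psi> t))\<^sup>2) \<partial>lborel) * ennreal ((norm (u y))\<^sup>2) \<partial>lborel)"
      by (simp add: nn_integral_multc nn_integral_lborel_translate[of "\<lambda>t. ennreal ((norm (?\<psi> t))\<^sup>2)"])
    also have "\<dots> = (\<integral>\<^sup>+ t. ennreal ((norm (?\<psi> t))\<^sup>2) \<partial>lborel) * ?n"
      by (rule nn_integral_cmult) measurable
    also have "\<dots> \<le> ennreal ((4 * pi / m) ^ DIM('a)) * ?n"
      by (intro mult_right_mono nn_integral_resolvent_source m) simp
    finally show ?thesis .
  qed
  have "(\<integral>\<^sup>+ x. ennreal ((norm (?I x))\<^sup>2) \<partial>lborel) \<le>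
      (\<integral>\<^sup>+ x. (\<integral>\<^sup>+ t. (\<integral>\<^sup>+ s. ?\<rho> t s * ?h s t x \<partial>lborel) \<partial>lborel) \<partial>lborel)"
    by (intro nn_integral_mono I_le)
  also have "\<dots> = (\<integral>\<^sup>+ t. (\<integral>\<^sup>+ x. (\<integral>\<^sup>+ s. ?\<rho> t s * ?h s t x \<partial>lborel) \<partial>lborel) \<partial>lborel)"
    by (rule lborel_pair.Fubini') measurable
  also have "\<dots> = (\<integral>\<^sup>+ t. (\<integral>\<^sup>+ s. (\<integral>\<^sup>+ x. ?\<rho> t s * ?h s t x \<partial>lborel) \<partial>lborel) \<partial>lborel)"
    by (rule nn_integral_cong, rule lborel_pair.Fubini') measurable
  also have "\<dots> = (\<integral>\<^sup>+ t. (\<integral>\<^sup>+ s. ?\<rho> t s * (\<integral>\<^sup>+ x. ?h s t x \<partial>lborel) \<partial>lborel) \<partial>lborel)"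
    by (intro nn_integral_cong nn_integral_cmult) measurable
  also have "\<dots> \<le> (\<integral>\<^sup>+ t. (\<integral>\<^sup>+ s. ?\<rho> t s * (?P * (ennreal (M\<^sup>2) * (?P * (\<integral>\<^sup>+ y. ennreal ((norm (v t y))\<^sup>2) \<partial>lborel)))) \<partial>lborel) \<partial>lborel)"
    by (intro nn_integral_mono mult_left_mono H_le) simp
  also have "\<dots> = (\<integral>\<^sup>+ t. ennreal ((2 * m) ^ DIM('a)) * (?P * (ennreal (M\<^sup>2) * (?P * (\<integral>\<^sup>+ y. ennreal ((norm (v t y))\<^sup>2) \<partial>lborel)))) \<partial>lborel)"
    by (simp add: nn_integral_multc nn_integral_lborel_reflect[of "\<lambda>s. ennreal (pair_kernel m s)"] nn_integral_pair_kernel[OF m])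
  also have "\<dots> = ennreal ((2 * m) ^ DIM('a)) * (?P * (ennreal (M\<^sup>2) * (?P * (\<integral>\<^sup>+ t. (\<integral>\<^sup>+ y. ennreal ((norm (v t y))\<^sup>2) \<partial>lborel) \<partial>lborel))))"
    by (simp add: nn_integral_cmult)
  also have "\<dots> \<le> ennreal ((2 * m) ^ DIM('a)) * (?P * (ennreal (M\<^sup>2) * (?P * (ennreal ((4 * pi / m) ^ DIM('a)) * ?n))))"
    by (intro mult_left_mono v_le) auto
  also have "\<dots> = ennreal ((2 * m) ^ DIM('a) * (2 * pi) ^ DIM('a) * M\<^sup>2 * (2 * pi) ^ DIM('a) * (4 * pi / m) ^ DIM('a)) * ?n"
    using m by (simp only: ennreal_mult zero_le_power zero_le_mult_iff mult.assoc pi_ge_zero zero_le_numeral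
      zero_le_divide_iff less_imp_le simp_thms power2_eq_square[symmetric] zero_le_power2)
  also have "(2 * m) ^ DIM('a) * (2 * pi) ^ DIM('a) * M\<^sup>2 * (2 * pi) ^ DIM('a) * (4 * pi / m) ^ DIM('a) =
      ((2 * m) * (2 * pi) * (2 * pi) * (4 * pi / m)) ^ DIM('a) * M\<^sup>2"
    by (simp only: power_mult_distrib mult_ac)
  also have "(2 * m) * (2 * pi) * (2 * pi) * (4 * pi / m) = 32 * pi ^ 3"
    using m by (simp add: power3_eq_cube)
  finally show ?thesis .
qed

section \<open>Smooth functions and products of first-order operators\<close>

lemma has_vector_derivative_partial_deriv:
  assumes f: "f differentiable at (p + t *\<^sub>R v)"
  shows "((\<lambda>t. f (p + t *\<^sub>R v)) has_vector_derivative partial_deriv v f (p + t *\<^sub>R v)) (at t)"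
proof -
  obtain D where D: "(f has_derivative D) (at (p + t *\<^sub>R v))"
    using f by (auto simp: differentiable_def)
  have *: "((\<lambda>s. f (q + s *\<^sub>R v)) has_vector_derivative D v) (at s)"
    if "q + s *\<^sub>R v = p + t *\<^sub>R v" for q s
  proof -
    have "((\<lambda>s. q + s *\<^sub>R v) has_vector_derivative v) (at s)"
      by (auto intro!: derivative_eq_intros)
    then show ?thesis
      using vector_derivative_diff_chain_within[of "\<lambda>s. q + s *\<^sub>R v" v s UNIV f D] D that
      by (simp add: o_def has_derivative_at_withinI)
  qed
  have "partial_deriv v f (p + t *\<^sub>R v) = D v"
    unfolding partial_deriv_def using *[of "p + t *\<^sub>R v" 0] by (intro vector_derivative_at) simp
  then show ?thesis using *[of p t] by simp
qed

lemma partial_deriv_eqI: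
  "((\<lambda>t. f (p + t *\<^sub>R v)) has_vector_derivative D) (at 0) \<Longrightarrow> partial_deriv v f p = D"
  unfolding partial_deriv_def by (rule vector_derivative_at)

lemma partial_deriv_at_0:
  "f differentiable at p \<Longrightarrow> ((\<lambda>t. f (p + t *\<^sub>R v)) has_vector_derivative partial_deriv v f p) (at 0)"
  using has_vector_derivative_partial_deriv[of f p 0 v] by simp

lemma smooth_differentiable: "smooth f \<Longrightarrow> f differentiable at p"
  unfolding smooth_def by (drule spec[of _ "[]"]) (simp add: differentiable_on_def)

lemma smooth_continuous_on: "smooth f \<Longrightarrow> continuous_on S f"
  by (meson differentiable_imp_continuous_within continuous_at_imp_continuous_on smooth_differentiable)

lemma smooth_partial_deriv:
  assumes "smooth f" "v \<in> Basis"
  shows "smooth (partial_deriv v f)"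
  unfolding smooth_def
proof (intro allI impI)
  fix vs :: "'a list" assume "set vs \<subseteq> Basis"
  then have "foldr partial_deriv (vs @ [v]) f differentiable_on UNIV"
    using assms unfolding smooth_def by (metis Un_subset_iff empty_subsetI insert_subset list.set(1) list.simps(15) set_append)
  then show "foldr partial_deriv vs (partial_deriv v f) differentiable_on UNIV" by simp
qed

text \<open>
  Smoothness is the largest property that implies differentiability and passes to partial
  derivatives in the coordinate directions.
\<close>

lemma smooth_coinduct:
  assumes "f \<in> S"
    and d: "\<And>g. g \<in> S \<Longrightarrow> g differentiable_on UNIV"
    and p: "\<And>g v. g \<in> S \<Longrightarrow> v \<in> Basis \<Longrightarrow> partial_deriv v g \<in> S"
  shows "smooth f"
proof -
  have "foldr partial_deriv vs f \<in> S" if "set vs \<subseteq> Basis" for vs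
    using that by (induction vs) (auto intro: p assms(1))
  then show ?thesis unfolding smooth_def by (auto intro: d)
qed

lemma partial_deriv_sum:
  fixes g :: "'i \<Rightarrow> 'a::euclidean_space \<Rightarrow> 'b::real_normed_vector"
  assumes "\<And>i. i \<in> I \<Longrightarrow> g i differentiable at p"
  shows "partial_deriv v (\<lambda>p. \<Sum>i\<in>I. c i *\<^sub>R g i p) p = (\<Sum>i\<in>I. c i *\<^sub>R partial_deriv v (g i) p)"
  by (intro partial_deriv_eqI has_vector_derivative_sum)
    (auto intro!: derivative_eq_intros partial_deriv_at_0 assms)

lemma partial_deriv_add_scaleR:
  assumes "f differentiable at p" "g differentiable at p"
  shows "partial_deriv v (\<lambda>p. f p + c *\<^sub>R g p) p = partial_deriv v f p + c *\<^sub>R partial_deriv v g p"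
  by (intro partial_deriv_eqI has_vector_derivative_add)
    (auto intro!: derivative_eq_intros partial_deriv_at_0 assms)

lemma smooth_add_scaleR:
  assumes "smooth f" "smooth g"
  shows "smooth (\<lambda>p. f p + c *\<^sub>R g p)"
proof (rule smooth_coinduct)
  show "(\<lambda>p. f p + c *\<^sub>R g p) \<in> {\<lambda>p. f p + c *\<^sub>R g p | f g. smooth f \<and> smooth g}"
    by (rule CollectI, rule exI[of _ f], rule exI[of _ g]) (simp add: assms)
  fix h :: "'a \<Rightarrow> 'b" assume "h \<in> {\<lambda>p. f p + c *\<^sub>R g p | f g. smooth f \<and> smooth g}"
  then obtain f g where h: "h = (\<lambda>p. f p + c *\<^sub>R g p)" "smooth f" "smooth g" by auto
  show "h differentiable_on UNIV"
    unfolding h(1) differentiable_on_def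
    by (intro ballI differentiable_add differentiable_scaleR differentiable_const
        smooth_differentiable[OF h(2)] smooth_differentiable[OF h(3)])
  fix v :: 'a assume v: "v \<in> Basis"
  have "partial_deriv v h = (\<lambda>p. partial_deriv v f p + c *\<^sub>R partial_deriv v g p)"
    unfolding h(1) by (intro ext partial_deriv_add_scaleR smooth_differentiable h)
  then show "partial_deriv v h \<in> {\<lambda>p. f p + c *\<^sub>R g p | f g. smooth f \<and> smooth g}"
    using smooth_partial_deriv[OF h(2) v] smooth_partial_deriv[OF h(3) v] by auto
qed

lemma partial_deriv_bounded_linear:
  assumes "bounded_linear L" "f differentiable at p"
  shows "partial_deriv v (\<lambda>p. L (f p)) p = L (partial_deriv v f p)"
  by (intro partial_deriv_eqI bounded_linear.has_vector_derivative[OF assms(1)] partial_deriv_at_0 assms(2))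

lemma smooth_bounded_linear:
  fixes f :: "'a::euclidean_space \<Rightarrow> 'b::real_normed_vector"
    and L :: "'b \<Rightarrow> 'c::real_normed_vector"
  assumes L: "bounded_linear L" and f: "smooth f"
  shows "smooth (\<lambda>p. L (f p))"
proof (rule smooth_coinduct)
  show "(\<lambda>p. L (f p)) \<in> {\<lambda>p. L (f p) | f. smooth f}"
    using f by auto
  fix h :: "'a \<Rightarrow> 'c" assume "h \<in> {\<lambda>p. L (f p) | f. smooth f}"
  then obtain f where h: "h = (\<lambda>p. L (f p))" "smooth f" by auto
  show "h differentiable_on UNIV"
    unfolding differentiable_on_def
  proof
    fix x
    obtain D where "(f has_derivative D) (at x)"
      using smooth_differentiable[OF h(2)] unfolding differentiable_def by blast
    from bounded_linear.has_derivative[OF L this] show "h differentiable (at x)"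
      unfolding h(1) differentiable_def by auto
  qed
  fix v :: 'a assume v: "v \<in> Basis"
  have "partial_deriv v h = (\<lambda>p. L (partial_deriv v f p))"
    unfolding h(1) by (intro ext partial_deriv_bounded_linear smooth_differentiable h L)
  then show "partial_deriv v h \<in> {\<lambda>p. L (f p) | f. smooth f}"
    using smooth_partial_deriv[OF h(2) v] by auto
qed

text \<open>
  The operator \<open>1 + c \<partial>\<^sub>v\<close>.
\<close>

definition shift_deriv :: "real \<Rightarrow> 'a::real_normed_vector \<Rightarrow> ('a \<Rightarrow> 'b::real_normed_vector) \<Rightarrow> 'a \<Rightarrow> 'b"
  where "shift_deriv c v f p = f p + c *\<^sub>R partial_deriv v f p"

lemma smooth_shift_deriv: "smooth f \<Longrightarrow> v \<in> Basis \<Longrightarrow> smooth (shift_deriv c v f)"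
  unfolding shift_deriv_def[abs_def] by (intro smooth_add_scaleR smooth_partial_deriv)

lemma smooth_shift_derivs:
  "smooth f \<Longrightarrow> d ` set vs \<subseteq> Basis \<Longrightarrow> smooth (foldr (\<lambda>i. shift_deriv (c i) (d i)) vs f)"
  by (induction vs) (auto intro: smooth_shift_deriv)

text \<open>
  The iterated derivative in the directions \<open>d i\<close> for those \<open>i\<close> of the list \<open>vs\<close> that lie in \<open>J\<close>, taken in
  the order of the list; for a list without repetitions these are the derivatives of order at most 1
  in each direction. The order is kept so that commuting partial derivatives is never needed.
\<close>

definition sub_deriv ::
    "('i \<Rightarrow> 'a::real_normed_vector) \<Rightarrow> 'i set \<Rightarrow> 'i list \<Rightarrow> ('a \<Rightarrow> 'b::real_normed_vector) \<Rightarrow> 'a \<Rightarrow> 'b"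
  where "sub_deriv d J vs = foldr (\<lambda>i. if i \<in> J then partial_deriv (d i) else id) vs"

lemma smooth_sub_deriv:
  "smooth f \<Longrightarrow> d ` set vs \<subseteq> Basis \<Longrightarrow> smooth (sub_deriv d J vs f)"
  unfolding sub_deriv_def by (induction vs) (auto intro: smooth_partial_deriv)

lemma sub_deriv_insert:
  "i \<notin> set vs \<Longrightarrow> sub_deriv d (insert i J) vs f = sub_deriv d J vs f"
  unfolding sub_deriv_def by (rule foldr_cong) auto

lemma sub_deriv_append_outside:
  "J \<inter> set ws = {} \<Longrightarrow> sub_deriv d J (ws @ us) f = sub_deriv d J us f"
  unfolding sub_deriv_def by (induction ws) auto

lemma shift_derivs_expand:
  assumes "smooth f" "distinct vs" "d ` set vs \<subseteq> Basis"
  shows "foldr (\<lambda>i. shift_deriv (c i) (d i)) vs f =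
    (\<lambda>p. \<Sum>J\<in>Pow (set vs). (\<Prod>i\<in>J. c i) *\<^sub>R sub_deriv d J vs f p)"
  using assms(2,3)
proof (induction vs)
  case Nil
  show ?case by (simp add: sub_deriv_def)
next
  case (Cons i vs)
  let ?D = "\<lambda>J. sub_deriv d J vs f" and ?P = "Pow (set vs)" and ?c = "\<lambda>J. \<Prod>i\<in>J. c i"
  have sm: "?D J differentiable at p" for J p
    using Cons.prems assms(1) by (intro smooth_differentiable smooth_sub_deriv) auto
  have i: "i \<notin> set vs" using Cons.prems by simp
  have J: "i \<notin> J" "finite J" if "J \<in> ?P" for J
    using that i by (auto intro: finite_subset)
  have inj: "inj_on (insert i) ?P" using i by (auto simp: inj_on_def)
  have disj: "?P \<inter> insert i ` ?P = {}" using i by auto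
  have "foldr (\<lambda>i. shift_deriv (c i) (d i)) (i # vs) f p =
     (\<Sum>J\<in>?P. ?c J *\<^sub>R ?D J p) + c i *\<^sub>R (\<Sum>J\<in>?P. ?c J *\<^sub>R partial_deriv (d i) (?D J) p)" for p
  proof -
    have "foldr (\<lambda>i. shift_deriv (c i) (d i)) (i # vs) f = shift_deriv (c i) (d i) (\<lambda>p. \<Sum>J\<in>?P. ?c J *\<^sub>R ?D J p)"
      using Cons by simp
    then show ?thesis by (simp only: shift_deriv_def partial_deriv_sum sm)
  qed
  also have "\<dots> p = (\<Sum>J\<in>Pow (set (i # vs)). ?c J *\<^sub>R sub_deriv d J (i # vs) f p)" for p
  proof -
    have "(\<Sum>J\<in>Pow (set (i # vs)). ?c J *\<^sub>R sub_deriv d J (i # vs) f p) =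
       (\<Sum>J\<in>?P. ?c J *\<^sub>R sub_deriv d J (i # vs) f p) +
       (\<Sum>J\<in>?P. ?c (insert i J) *\<^sub>R sub_deriv d (insert i J) (i # vs) f p)"
      by (simp add: Pow_insert sum.union_disjoint[OF _ _ disj] sum.reindex[OF inj])
    also have "(\<Sum>J\<in>?P. ?c J *\<^sub>R sub_deriv d J (i # vs) f p) = (\<Sum>J\<in>?P. ?c J *\<^sub>R ?D J p)"
      using J by (intro sum.cong refl) (simp add: sub_deriv_def)
    also have "(\<Sum>J\<in>?P. ?c (insert i J) *\<^sub>R sub_deriv d (insert i J) (i # vs) f p) =
        (\<Sum>J\<in>?P. c i *\<^sub>R ?c J *\<^sub>R partial_deriv (d i) (?D J) p)"
    proof (intro sum.cong refl)
      fix J assume "J \<in> ?P"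
      moreover have "sub_deriv d (insert i J) (i # vs) f = partial_deriv (d i) (?D J)"
        using sub_deriv_insert[OF i, of d J f] by (simp add: sub_deriv_def)
      ultimately show "?c (insert i J) *\<^sub>R sub_deriv d (insert i J) (i # vs) f p = c i *\<^sub>R ?c J *\<^sub>R partial_deriv (d i) (?D J) p"
        using J by simp
    qed
    finally show ?thesis by (simp add: scaleR_sum_right)
  qed
  finally show ?case by (simp add: fun_eq_iff)
qed

text \<open>
  The list \<open>ws\<close> allows one bound, for the derivatives along a full list, to serve for all its suffixes.
\<close>

lemma norm_shift_derivs_le:
  assumes "smooth f" "distinct (ws @ vs)" "d ` set vs \<subseteq> Basis"
    and M: "\<And>J. J \<subseteq> set vs \<Longrightarrow> norm ((\<Prod>i\<in>J. c i) *\<^sub>R sub_deriv d J (ws @ vs) f p) \<le> M"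
  shows "norm (foldr (\<lambda>i. shift_deriv (c i) (d i)) vs f p) \<le> 2 ^ length vs * M"
proof -
  have "norm (foldr (\<lambda>i. shift_deriv (c i) (d i)) vs f p) \<le>
      (\<Sum>J\<in>Pow (set vs). norm ((\<Prod>i\<in>J. c i) *\<^sub>R sub_deriv d J vs f p))"
    using assms by (subst shift_derivs_expand) (auto simp del: norm_scaleR intro!: norm_sum)
  also have "\<dots> \<le> (\<Sum>J\<in>Pow (set vs). M)"
  proof (intro sum_mono)
    fix J assume J: "J \<in> Pow (set vs)"
    then have "J \<inter> set ws = {}" using assms(2) by auto
    from sub_deriv_append_outside[OF this, of d vs f]
    show "norm ((\<Prod>i\<in>J. c i) *\<^sub>R sub_deriv d J vs f p) \<le> M"
      using M[of J] J by simp
  qed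
  also have "\<dots> = 2 ^ length vs * M"
    using assms(2) by (simp add: card_Pow distinct_card)
  finally show ?thesis .
qed

lemma shift_derivs_vanish:
  fixes f :: "'a::real_normed_vector \<Rightarrow> 'b::real_normed_vector"
  assumes U: "open U" and f: "\<And>p. p \<in> U \<Longrightarrow> f p = 0" and p: "p \<in> U"
  shows "foldr (\<lambda>i. shift_deriv (c i) (d i)) vs f p = 0"
  using p
proof (induction vs arbitrary: p)
  case (Cons i vs)
  let ?g = "foldr (\<lambda>i. shift_deriv (c i) (d i)) vs f"
  have S: "open ((\<lambda>t. p + t *\<^sub>R d i) -` U)"
    by (intro open_vimage U continuous_intros)
  have "((\<lambda>t. 0 :: 'b) has_vector_derivative 0) (at (0::real))" by simp
  then have "((\<lambda>t. ?g (p + t *\<^sub>R d i)) has_vector_derivative 0) (at 0)"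
    by (rule has_vector_derivative_transform_within_open[OF _ S]) (use Cons in auto)
  then have "partial_deriv (d i) ?g p = 0" by (rule partial_deriv_eqI)
  moreover have "?g p = 0" using Cons by simp
  ultimately show ?case by (simp add: shift_deriv_def[of _ _ ?g])
qed (use f in auto)

section \<open>Averaging in the position and integrating by parts in the frequency\<close>

text \<open>
  The iteration of \<open>exponential_average\<close> over a list of directions. The functions obtained from the
  suffixes of the list have to be bounded, since each of them is averaged in turn.
\<close>

lemma exponential_average_PiM:
  fixes g :: "'p::euclidean_space \<Rightarrow> 'b::euclidean_space" and d :: "'i \<Rightarrow> 'p"
  assumes m: "m > 0" and g: "smooth g" and "distinct vs" "d ` set vs \<subseteq> Basis"
    and "\<And>ws us. vs = ws @ us \<Longrightarrow>
      \<exists>K. \<forall>p. norm (foldr (\<lambda>i. shift_deriv (1 / m) (d i)) us g p) \<le> K"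
  shows "g p = (LINT t|PiM (set vs) (\<lambda>_. lborel). (\<Prod>i\<in>set vs. exponential_density m (t i)) *\<^sub>R
    foldr (\<lambda>i. shift_deriv (1 / m) (d i)) vs g (p - (\<Sum>i\<in>set vs. t i *\<^sub>R d i)))"
  using assms(3-)
proof (induction vs arbitrary: p)
  case Nil
  show ?case by (simp add: PiM_empty lebesgue_integral_count_space_finite)
next
  case (Cons i vs)
  interpret product_sigma_finite "\<lambda>_::'i. lborel :: real measure"
    by (rule product_sigma_finite_lborel)
  let ?h = "foldr (\<lambda>i. shift_deriv (1 / m) (d i)) vs g"
  let ?k = "foldr (\<lambda>i. shift_deriv (1 / m) (d i)) (i # vs) g"
  have i: "i \<notin> set vs" "d i \<in> Basis" "distinct vs" "d ` set vs \<subseteq> Basis" using Cons.prems by auto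
  have k_eq: "?k p = ?h p + (1 / m) *\<^sub>R partial_deriv (d i) ?h p" for p
    by (simp only: foldr.simps o_apply shift_deriv_def)
  have sh: "smooth ?h" and sk: "smooth ?k"
    using Cons.prems by (intro smooth_shift_derivs g; auto)+
  obtain K1 where K1: "norm (?h p) \<le> K1" for p using Cons.prems(3)[of "[i]" vs] by auto
  obtain K2 where K2: "norm (?k p) \<le> K2" for p using Cons.prems(3)[of "[]" "i # vs"] by auto
  have K2_0: "0 \<le> K2" by (rule order_trans[OF norm_ge_zero K2])
  have pd: "norm (partial_deriv (d i) ?h p) \<le> m * (K2 + K1)" for p
  proof -
    have "partial_deriv (d i) ?h p = m *\<^sub>R (?k p - ?h p)" using m by (simp only: k_eq) simp
    then have "norm (partial_deriv (d i) ?h p) = m * norm (?k p - ?h p)" using m by simp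
    also have "\<dots> \<le> m * (K2 + K1)"
      using m by (intro mult_left_mono order_trans[OF norm_triangle_ineq4] add_mono K1 K2) auto
    finally show ?thesis .
  qed
  have one: "?h q = (LINT r|lborel. exponential_density m r *\<^sub>R ?k (q - r *\<^sub>R d i))" for q
  proof -
    have "?h (q + 0 *\<^sub>R d i) = (LINT r|lborel. exponential_density m r *\<^sub>R
       (?h (q + (0 - r) *\<^sub>R d i) + (1 / m) *\<^sub>R partial_deriv (d i) ?h (q + (0 - r) *\<^sub>R d i)))"
    proof (rule exponential_average[OF m])
      show "((\<lambda>t. ?h (q + t *\<^sub>R d i)) has_vector_derivative partial_deriv (d i) ?h (q + t *\<^sub>R d i)) (at t)" for t
        by (intro has_vector_derivative_partial_deriv smooth_differentiable sh)
      show "continuous_on UNIV (\<lambda>t. partial_deriv (d i) ?h (q + t *\<^sub>R d i))"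
        by (rule continuous_on_compose2[OF smooth_continuous_on[OF smooth_partial_deriv[OF sh i(2)]]])
          (auto intro!: continuous_intros)
    qed (rule K1, rule pd)
    then show ?thesis unfolding k_eq by simp
  qed
  have [measurable]: "?k \<in> borel_measurable borel"
    by (intro borel_measurable_continuous_onI smooth_continuous_on sk)
  let ?G = "\<lambda>t. (\<Prod>j\<in>set (i # vs). exponential_density m (t j)) *\<^sub>R ?k (p - (\<Sum>j\<in>set (i # vs). t j *\<^sub>R d j))"
  have int: "integrable (PiM (insert i (set vs)) (\<lambda>_. lborel)) ?G"
  proof (rule Bochner_Integration.integrable_bound)
    show "integrable (PiM (insert i (set vs)) (\<lambda>_. lborel)) (\<lambda>t. (\<Prod>j\<in>insert i (set vs). exponential_density m (t j)) * K2)"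
      by (intro integrable_mult_left product_integrable_prod exponential_density_integral m) simp
    show "AE t in PiM (insert i (set vs)) (\<lambda>_. lborel). norm (?G t) \<le> norm ((\<Prod>j\<in>insert i (set vs). exponential_density m (t j)) * K2)"
    proof (rule AE_I2)
      fix t
      have "norm (?G t) \<le> \<bar>\<Prod>j\<in>insert i (set vs). exponential_density m (t j)\<bar> * K2"
        unfolding norm_scaleR list.set by (intro mult_left_mono K2) simp
      then show "norm (?G t) \<le> norm ((\<Prod>j\<in>insert i (set vs). exponential_density m (t j)) * K2)"
        using K2_0 unfolding real_norm_def abs_mult by (simp only: abs_of_nonneg)
    qed
  qed measurable
  have "g p = (LINT t|PiM (set vs) (\<lambda>_. lborel). (\<Prod>j\<in>set vs. exponential_density m (t j)) *\<^sub>R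
      ?h (p - (\<Sum>j\<in>set vs. t j *\<^sub>R d j)))"
    using Cons.prems(3) by (intro Cons.IH i) (metis append_Cons)
  also have "\<dots> = (LINT t|PiM (set vs) (\<lambda>_. lborel). (LINT y|lborel. ?G (t(i := y))))"
  proof (rule Bochner_Integration.integral_cong[OF refl])
    fix t :: "'i \<Rightarrow> real"
    have 1: "(\<Prod>j\<in>set vs. exponential_density m ((t(i := y)) j)) = (\<Prod>j\<in>set vs. exponential_density m (t j))"
      "(\<Sum>j\<in>set vs. (t(i := y)) j *\<^sub>R d j) = (\<Sum>j\<in>set vs. t j *\<^sub>R d j)" for y
      using i(1) by (auto intro!: prod.cong sum.cong)
    have "?G (t(i := y)) = (\<Prod>j\<in>set vs. exponential_density m (t j)) *\<^sub>R
        (exponential_density m y *\<^sub>R ?k ((p - (\<Sum>j\<in>set vs. t j *\<^sub>R d j)) - y *\<^sub>R d i))" for y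
      unfolding list.set prod.insert[OF finite_set i(1)] sum.insert[OF finite_set i(1)] 1
      by (simp add: algebra_simps)
    then show "(\<Prod>j\<in>set vs. exponential_density m (t j)) *\<^sub>R ?h (p - (\<Sum>j\<in>set vs. t j *\<^sub>R d j)) =
        (LINT y|lborel. ?G (t(i := y)))"
      unfolding one[of "p - (\<Sum>j\<in>set vs. t j *\<^sub>R d j)"] by (simp only: integral_scaleR_right)
  qed
  also have "\<dots> = (LINT t|PiM (insert i (set vs)) (\<lambda>_. lborel). ?G t)"
    by (rule product_integral_insert[OF _ i(1) int, symmetric]) simp
  finally show ?case by (simp only: list.set)
qed

lemma exponential_average_fst:
  fixes g :: "'a::euclidean_space \<times> 'a \<Rightarrow> 'b::euclidean_space"
  assumes m: "m > 0" and g: "smooth g" and bs: "distinct bs" "set bs = (Basis :: 'a set)"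
    and bnd: "\<And>ws us. bs = ws @ us \<Longrightarrow>
      \<exists>K. \<forall>p. norm (foldr (\<lambda>b. shift_deriv (1 / m) (b, 0)) us g p) \<le> K"
  shows "g (x, \<xi>) = (LINT s|lborel. exp_kernel m (x - s) *\<^sub>R
    foldr (\<lambda>b. shift_deriv (1 / m) (b, 0)) bs g (s, \<xi>))"
proof -
  let ?k = "foldr (\<lambda>b. shift_deriv (1 / m) (b, 0)) bs g"
  let ?G = "\<lambda>s. exp_kernel m s *\<^sub>R ?k (x - s, \<xi>)"
  have sub: "(\<lambda>b::'a. (b, 0 :: 'a)) ` set bs \<subseteq> Basis"
    unfolding bs Basis_prod_def by auto
  have ck: "continuous_on UNIV ?k"
    by (intro smooth_continuous_on smooth_shift_derivs g sub)
  have [measurable]: "(\<lambda>s. ?k (x - s, \<xi>)) \<in> borel_measurable borel"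
    by (intro borel_measurable_continuous_onI continuous_on_compose2[OF ck]) (auto intro!: continuous_intros)
  have [measurable]: "(\<lambda>s. ?k (s, \<xi>)) \<in> borel_measurable borel"
    by (intro borel_measurable_continuous_onI continuous_on_compose2[OF ck]) (auto intro!: continuous_intros)
  have "g (x, \<xi>) = (LINT t|PiM Basis (\<lambda>_. lborel). (\<Prod>b\<in>Basis. exponential_density m (t b)) *\<^sub>R
     ?k ((x, \<xi>) - (\<Sum>b\<in>Basis. t b *\<^sub>R (b, 0))))"
    using exponential_average_PiM[OF m g bs(1) sub bnd] unfolding bs by simp
  also have "\<dots> = (LINT t|PiM Basis (\<lambda>_. lborel). ?G (\<Sum>b\<in>Basis. t b *\<^sub>R b))"
  proof (rule Bochner_Integration.integral_cong[OF refl])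
    fix t :: "'a \<Rightarrow> real"
    have 1: "(\<Sum>b\<in>Basis. t b *\<^sub>R (b, 0 :: 'a)) = (\<Sum>b\<in>Basis. t b *\<^sub>R b, 0)"
      by (rule prod_eqI) (simp_all add: fst_sum snd_sum)
    have 2: "exp_kernel m (\<Sum>b\<in>Basis. t b *\<^sub>R b) = (\<Prod>b\<in>Basis. exponential_density m (t b))"
      unfolding exp_kernel_def by (intro prod.cong refl) simp
    show "(\<Prod>b\<in>Basis. exponential_density m (t b)) *\<^sub>R ?k ((x, \<xi>) - (\<Sum>b\<in>Basis. t b *\<^sub>R (b, 0))) =
       ?G (\<Sum>b\<in>Basis. t b *\<^sub>R b)"
      unfolding 1 2 by simp
  qed
  also have "\<dots> = integral\<^sup>L lborel ?G"
    by (rule lborel_PiM(2)[symmetric]) measurable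
  also have "\<dots> = (LINT s|lborel. ?G (x - s))"
    by (rule lborel_integral_reflect[symmetric]) measurable
  finally show ?thesis by simp
qed

lemma integrable_compact_support:
  fixes f :: "'a::euclidean_space \<Rightarrow> 'b::euclidean_space"
  assumes f: "continuous_on UNIV f" and z: "\<And>x. norm x > R \<Longrightarrow> f x = 0"
  obtains K where "0 \<le> K" "\<And>x. norm (f x) \<le> K * indicator (cball 0 R) x" "integrable lborel f"
proof -
  have "bounded (f ` cball 0 R)"
    by (intro compact_imp_bounded compact_continuous_image continuous_on_subset[OF f]) auto
  then obtain K where "K > 0" "\<forall>y\<in>f ` cball 0 R. norm y \<le> K"
    unfolding bounded_pos by blast
  then have K: "\<And>x. x \<in> cball 0 R \<Longrightarrow> norm (f x) \<le> K" "K > 0" by blast+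
  have le: "norm (f x) \<le> K * indicator (cball 0 R) x" for x
    using K z[of x] by (cases "x \<in> cball 0 R") auto
  have "integrable lborel f"
  proof (rule Bochner_Integration.integrable_bound)
    show "integrable lborel (\<lambda>x. K * indicator (cball (0::'a) R) x)"
      by (intro integrable_mult_right integrable_indicator_cball)
    show "AE x in lborel. norm (f x) \<le> norm (K * indicator (cball 0 R) x)"
      unfolding real_norm_def by (intro AE_I2 order_trans[OF le abs_ge_self])
  qed (use f in \<open>simp add: borel_measurable_continuous_onI\<close>)
  with that[OF _ le] K show ?thesis by simp
qed

text \<open>
  The integral of \<open>F (x + e) - F x\<close> vanishes by translation invariance, and this difference is the
  integral of \<open>F' (x + t e)\<close> over \<open>t\<close> in the unit interval.
\<close>

lemma integral_directional_derivative_eq_0: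
  fixes F F' :: "'a::euclidean_space \<Rightarrow> 'b::euclidean_space"
  assumes d: "\<And>x t. ((\<lambda>t. F (x + t *\<^sub>R e)) has_vector_derivative F' (x + t *\<^sub>R e)) (at t)"
    and c: "continuous_on UNIV F" "continuous_on UNIV F'"
    and z: "\<And>x. norm x > R \<Longrightarrow> F x = 0" "\<And>x. norm x > R \<Longrightarrow> F' x = 0"
  shows "integral\<^sup>L lborel F' = 0"
proof -
  obtain K where K: "0 \<le> K" "\<And>x. norm (F' x) \<le> K * indicator (cball 0 R) x"
    using integrable_compact_support[OF c(2) z(2)] by metis
  have iF: "integrable lborel F"
    using integrable_compact_support[OF c(1) z(1)] by metis
  have [measurable]: "F \<in> borel_measurable borel" "F' \<in> borel_measurable borel"
    using c by (auto intro: borel_measurable_continuous_onI)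
  have iF1: "integrable lborel (\<lambda>x. F (x + e))"
  proof -
    have "integrable lborel (\<lambda>x. F (e + x))"
      using iF lborel_distr_plus[of e] integrable_distr_eq[of "(+) e" lborel borel F] by simp
    then show ?thesis by (simp add: add.commute)
  qed
  have ftc: "(LINT t|lborel. indicator {0..1} t *\<^sub>R F' (x + t *\<^sub>R e)) = F (x + e) - F x" for x
  proof -
    have "(LINT t|lborel. indicator {0..1} t *\<^sub>R F' (x + t *\<^sub>R e)) = F (x + 1 *\<^sub>R e) - F (x + 0 *\<^sub>R e)"
    proof (rule integral_FTC_atLeastAtMost)
      show "continuous_on {0..1} (\<lambda>t. F' (x + t *\<^sub>R e))"
        by (rule continuous_on_compose2[OF c(2)]) (auto intro!: continuous_intros)
    qed (auto intro: has_vector_derivative_at_within[OF d])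
    then show ?thesis by simp
  qed
  have "0 = (LINT x|lborel. F (x + e) - F x)"
    using iF iF1 by (simp add: lborel_integral_translate)
  also have "\<dots> = (LINT x|lborel. LINT t|lborel. indicator {0..1} t *\<^sub>R F' (x + t *\<^sub>R e))"
    by (simp only: ftc)
  also have "\<dots> = (LINT t|lborel. LINT x|lborel. indicator {0..1} t *\<^sub>R F' (x + t *\<^sub>R e))"
  proof (rule Fubini_dominated(1))
    show "integrable lborel (\<lambda>x. K * indicator (cball (0::'a) (R + norm e)) x)"
      by (intro integrable_mult_right integrable_indicator_cball)
    show "integrable lborel (indicator {0..1} :: real \<Rightarrow> real)" by simp
    show "norm (indicator {0..1} t *\<^sub>R F' (x + t *\<^sub>R e)) \<le> K * indicator (cball 0 (R + norm e)) x * indicator {0..1} t" for x and t :: real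
    proof (cases "t \<in> {0..1}")
      case True
      then have "norm (t *\<^sub>R e) \<le> norm e" by (simp add: mult_left_le_one_le)
      moreover have "norm x \<le> norm (x + t *\<^sub>R e) + norm (t *\<^sub>R e)"
        by (metis add_diff_cancel_right' norm_triangle_ineq4)
      ultimately have "indicator (cball 0 R) (x + t *\<^sub>R e) \<le> (indicator (cball 0 (R + norm e)) x :: real)"
        by (auto simp: indicator_def)
      then have "K * indicator (cball 0 R) (x + t *\<^sub>R e) \<le> K * indicator (cball 0 (R + norm e)) x"
        using K(1) by (rule mult_left_mono)
      with K(2)[of "x + t *\<^sub>R e"] True show ?thesis by simp
    qed simp
  qed measurable
  also have "\<dots> = (LINT t|lborel. indicator {0..1::real} t *\<^sub>R integral\<^sup>L lborel F')"
    by (simp add: lborel_integral_translate)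
  also have "\<dots> = integral\<^sup>L lborel F'"
    by (subst integral_scaleR_left) auto
  finally show ?thesis by simp
qed

lemma fourier_shift_deriv:
  fixes g :: "'a::euclidean_space \<times> 'a \<Rightarrow> complex"
  assumes g: "smooth g" and e: "e \<in> Basis" and z: "\<And>x \<xi>. norm \<xi> > R \<Longrightarrow> g (x, \<xi>) = 0"
  shows "(LINT \<xi>|lborel. cis (\<xi> \<bullet> z) * shift_deriv (- m) (0, e) g (x, \<xi>)) =
    (1 + \<i> * m * (z \<bullet> e)) * (LINT \<xi>|lborel. cis (\<xi> \<bullet> z) * g (x, \<xi>))"
proof -
  let ?g' = "partial_deriv (0, e) g"
  have e': "(0, e) \<in> (Basis :: ('a \<times> 'a) set)" using e by (auto simp: Basis_prod_def)
  have cg: "continuous_on UNIV g" "continuous_on UNIV ?g'"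
    using smooth_partial_deriv[OF g e'] g by (auto intro: smooth_continuous_on)
  have ccis: "continuous_on UNIV (\<lambda>\<xi>. cis (\<xi> \<bullet> z))"
    unfolding cis_eq_exp by (intro continuous_intros)
  define F where "F \<xi> = cis (\<xi> \<bullet> z) * g (x, \<xi>)" for \<xi>
  define F1 where "F1 \<xi> = cis (\<xi> \<bullet> z) * ?g' (x, \<xi>)" for \<xi>
  have cF: "continuous_on UNIV F" "continuous_on UNIV F1"
    unfolding F_def F1_def
    by (intro continuous_intros ccis continuous_on_compose2[OF cg(1)] continuous_on_compose2[OF cg(2)]; auto intro!: continuous_intros)+
  have g'0: "?g' (x, \<xi>) = 0" if "norm \<xi> > R" for x \<xi>
  proof -
    have "foldr (\<lambda>i. shift_deriv 1 i) [(0, e)] g (x, \<xi>) = 0"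
    proof (rule shift_derivs_vanish)
      show "open {p :: 'a \<times> 'a. norm (snd p) > R}"
        by (intro open_Collect_less continuous_intros)
    qed (use that z in auto)
    then show ?thesis using z[OF that] by (simp add: shift_deriv_def)
  qed
  have zF: "F \<xi> = 0" "F1 \<xi> = 0" if "norm \<xi> > R" for \<xi>
    using z[OF that] g'0[OF that] by (auto simp: F_def F1_def)
  have iF: "integrable lborel F" "integrable lborel F1"
    using integrable_compact_support[OF cF(1) zF(1)] integrable_compact_support[OF cF(2) zF(2)] by metis+
  have "integral\<^sup>L lborel (\<lambda>\<xi>. \<i> * (z \<bullet> e) * F \<xi> + F1 \<xi>) = 0"
  proof (rule integral_directional_derivative_eq_0[where F = F and e = e and R = R])
    fix \<xi> t
    have pair: "(x, \<xi>) + s *\<^sub>R (0, e) = (x, \<xi> + s *\<^sub>R e)" for s by simp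
    have 1: "((\<lambda>t. g (x, \<xi> + t *\<^sub>R e)) has_vector_derivative ?g' (x, \<xi> + t *\<^sub>R e)) (at t)"
      using has_vector_derivative_partial_deriv[where p = "(x, \<xi>)" and t = t and v = "(0, e)" and f = g]
        smooth_differentiable[OF g] unfolding pair by blast
    have 2: "((\<lambda>t. cis ((\<xi> + t *\<^sub>R e) \<bullet> z)) has_vector_derivative (e \<bullet> z) *\<^sub>R (\<i> * cis ((\<xi> + t *\<^sub>R e) \<bullet> z))) (at t)"
    proof -
      have "((\<lambda>t. (\<xi> + t *\<^sub>R e) \<bullet> z) has_vector_derivative (e \<bullet> z)) (at t)"
        unfolding inner_add_left inner_scaleR_left by (auto intro!: derivative_eq_intros)
      moreover have "(cis has_vector_derivative \<i> * cis r) (at r)" for r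
        unfolding cis_eq_exp[abs_def]
        by (rule has_vector_derivative_real_field[where f = "\<lambda>w. exp (\<i> * w)"]) (auto intro!: derivative_eq_intros)
      ultimately show ?thesis
        by (rule vector_diff_chain_at[unfolded o_def])
    qed
    show "((\<lambda>t. F (\<xi> + t *\<^sub>R e)) has_vector_derivative
        \<i> * (z \<bullet> e) * F (\<xi> + t *\<^sub>R e) + F1 (\<xi> + t *\<^sub>R e)) (at t)"
      unfolding F_def F1_def
      by (rule has_vector_derivative_eq_rhs[OF has_vector_derivative_mult[OF 2 1]])
        (simp add: scaleR_conv_of_real inner_commute)
  qed (use cF zF in \<open>auto intro!: continuous_intros\<close>)
  then have *: "integral\<^sup>L lborel F1 = - (\<i> * (z \<bullet> e) * integral\<^sup>L lborel F)"
    using iF by (simp add: add_eq_0_iff)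
  have "(LINT \<xi>|lborel. cis (\<xi> \<bullet> z) * shift_deriv (- m) (0, e) g (x, \<xi>)) = (LINT \<xi>|lborel. F \<xi> - m * F1 \<xi>)"
    by (simp add: shift_deriv_def F_def F1_def algebra_simps scaleR_conv_of_real)
  also have "\<dots> = (1 + \<i> * m * (z \<bullet> e)) * integral\<^sup>L lborel F"
    using iF by (simp add: * algebra_simps)
  also have "integral\<^sup>L lborel F = (LINT \<xi>|lborel. cis (\<xi> \<bullet> z) * g (x, \<xi>))"
    by (simp add: F_def[abs_def])
  finally show ?thesis .
qed

lemma fourier_shift_derivs:
  fixes g :: "'a::euclidean_space \<times> 'a \<Rightarrow> complex"
  assumes g: "smooth g" and z: "\<And>x \<xi>. norm \<xi> > R \<Longrightarrow> g (x, \<xi>) = 0"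
    and "distinct vs" "set vs \<subseteq> Basis"
  shows "(LINT \<xi>|lborel. cis (\<xi> \<bullet> z) * foldr (\<lambda>b. shift_deriv (- m) (0, b)) vs g (x, \<xi>)) =
    (\<Prod>b\<in>set vs. 1 + \<i> * m * (z \<bullet> b)) * (LINT \<xi>|lborel. cis (\<xi> \<bullet> z) * g (x, \<xi>))"
  using assms(3,4)
proof (induction vs)
  case (Cons b vs)
  let ?h = "foldr (\<lambda>b. shift_deriv (- m) (0, b)) vs g"
  have sub: "(\<lambda>b::'a. (0 :: 'a, b)) ` set vs \<subseteq> Basis"
    using Cons.prems unfolding Basis_prod_def by auto
  have h0: "?h (x, \<xi>) = 0" if "norm \<xi> > R" for x \<xi>
  proof (rule shift_derivs_vanish)
    show "open {p :: 'a \<times> 'a. norm (snd p) > R}"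
      by (intro open_Collect_less continuous_intros)
  qed (use that z in auto)
  have "(LINT \<xi>|lborel. cis (\<xi> \<bullet> z) * foldr (\<lambda>b. shift_deriv (- m) (0, b)) (b # vs) g (x, \<xi>)) =
    (1 + \<i> * m * (z \<bullet> b)) * (LINT \<xi>|lborel. cis (\<xi> \<bullet> z) * ?h (x, \<xi>))"
    using fourier_shift_deriv[OF smooth_shift_derivs[OF g sub] _ h0, of b R z m x] Cons.prems by simp
  then show ?case using Cons by (simp add: mult.assoc)
qed simp

text \<open>
  The theorem for scalar symbols. The index \<open>Inl b\<close> stands for the derivative in the position and
  \<open>Inr b\<close> for that in the frequency, in the direction \<open>b\<close>. The factor \<open>4 ^ DIM('a)\<close> counts the terms of
  the product of \<open>2 * DIM('a)\<close> operators of the form \<open>1 + c \<partial>\<^sub>v\<close>.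
\<close>

lemma nn_integral_symbol_le:
  fixes a :: "'a::euclidean_space \<times> 'a \<Rightarrow> complex" and bs :: "'a list"
    and m R M :: real
  defines "dirs \<equiv> map Inl bs @ map Inr bs"
    and "D \<equiv> case_sum (\<lambda>b. (b, 0)) (\<lambda>b. (0, b))"
    and "\<kappa> \<equiv> case_sum (\<lambda>_. 1 / m) (\<lambda>_. - m)"
  assumes m: "m > 0" and a: "smooth a" and bs: "distinct bs" "set bs = (Basis :: 'a set)"
    and z: "\<And>x \<xi>. norm \<xi> > R \<Longrightarrow> a (x, \<xi>) = 0"
    and M: "\<And>J p. J \<subseteq> set dirs \<Longrightarrow> norm ((\<Prod>i\<in>J. \<kappa> i) *\<^sub>R sub_deriv D J dirs a p) \<le> M"
    and u: "integrable lborel u"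
  shows "(\<integral>\<^sup>+ x. ennreal ((norm (LINT \<xi>|lborel. LINT y|lborel.
        cis (\<xi> \<bullet> (x - y)) * (a (x, \<xi>) * u y)))\<^sup>2) \<partial>lborel)
     \<le> ennreal ((32 * pi ^ 3) ^ DIM('a) * (4 ^ DIM('a) * M)\<^sup>2) * (\<integral>\<^sup>+ y. ennreal ((norm (u y))\<^sup>2) \<partial>lborel)"
proof -
  define b where "b = foldr (\<lambda>b. shift_deriv (- m) (0, b)) bs a"
  define B where "B = foldr (\<lambda>b. shift_deriv (1 / m) (b, 0)) bs b"
  have dd: "distinct dirs" unfolding dirs_def using bs by (auto simp: distinct_map)
  have sub: "D ` set dirs \<subseteq> Basis" unfolding dirs_def D_def using bs by (auto simp: Basis_prod_def)
  have suffix: "foldr (\<lambda>b. shift_deriv (1 / m) (b, 0)) us b =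
      foldr (\<lambda>i. shift_deriv (\<kappa> i) (D i)) (map Inl us @ map Inr bs) a" for us
    by (simp add: b_def D_def \<kappa>_def foldr_map o_def)
  have bound: "norm (foldr (\<lambda>b. shift_deriv (1 / m) (b, 0)) us b p) \<le> 2 ^ (length us + length bs) * M"
    if "bs = ws @ us" for ws us p
  proof -
    have "norm (foldr (\<lambda>i. shift_deriv (\<kappa> i) (D i)) (map Inl us @ map Inr bs) a p) \<le>
        2 ^ length (map Inl us @ map Inr bs :: ('a + 'a) list) * M"
    proof (rule norm_shift_derivs_le[OF a, where ws = "map Inl ws"])
      have eq: "map Inl ws @ map Inl us @ map Inr bs = dirs" using that by (simp add: dirs_def)
      show "distinct (map Inl ws @ map Inl us @ map Inr bs)" unfolding eq by (rule dd)
      have s: "set (map Inl us @ map Inr bs) \<subseteq> set dirs" using that by (auto simp: dirs_def)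
      show "D ` set (map Inl us @ map Inr bs) \<subseteq> Basis" by (rule order_trans[OF image_mono[OF s] sub])
      show "norm ((\<Prod>i\<in>J. \<kappa> i) *\<^sub>R sub_deriv D J (map Inl ws @ map Inl us @ map Inr bs) a p) \<le> M"
        if "J \<subseteq> set (map Inl us @ map Inr bs)" for J
        unfolding eq by (rule M[OF order_trans[OF that s]])
    qed
    then show ?thesis unfolding suffix by simp
  qed
  have len: "length bs = DIM('a)" using bs distinct_card by metis
  have "(2::real) ^ (length bs + length bs) = 4 ^ DIM('a)"
    unfolding len mult_2[symmetric] power_mult by simp
  then have B_bound: "norm (B p) \<le> 4 ^ DIM('a) * M" for p
    using bound[of "[]" bs p] unfolding B_def by simp
  have B_eq: "B = foldr (\<lambda>i. shift_deriv (\<kappa> i) (D i)) dirs a"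
    unfolding B_def suffix dirs_def ..
  have B0: "B (x, \<xi>) = 0" if "norm \<xi> > R" for x \<xi>
    unfolding B_eq
  proof (rule shift_derivs_vanish)
    show "open {p :: 'a \<times> 'a. norm (snd p) > R}"
      by (intro open_Collect_less continuous_intros)
  qed (use that z in auto)
  have a_bound: "norm (a p) \<le> M" for p
    using M[of "{}" p] sub_deriv_append_outside[of "{}" dirs D "[]" a] by (simp add: sub_deriv_def[of D "{}" "[]"])
  have M0: "0 \<le> M" by (rule order_trans[OF norm_ge_zero a_bound])
  have sub1: "(\<lambda>b::'a. (b, 0 :: 'a)) ` set bs \<subseteq> Basis" "(\<lambda>b::'a. (0 :: 'a, b)) ` set bs \<subseteq> Basis"
    unfolding bs Basis_prod_def by auto
  have sb: "smooth b" unfolding b_def by (intro smooth_shift_derivs a sub1)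
  have sB: "smooth B" unfolding B_def by (intro smooth_shift_derivs sb sub1)
  show ?thesis
  proof (rule nn_integral_localized_quantization_le[OF m _ _ _ _ _ _ u])
    show "a \<in> borel_measurable (borel \<Otimes>\<^sub>M borel)" "B \<in> borel_measurable (borel \<Otimes>\<^sub>M borel)"
      unfolding borel_prod using a sB by (auto intro!: borel_measurable_continuous_onI smooth_continuous_on)
    show "norm (a (x, \<xi>)) \<le> M * indicator (cball 0 R) \<xi>" for x \<xi>
      using a_bound[of "(x, \<xi>)"] z[of \<xi> x] by (cases "norm \<xi> \<le> R") auto
    show "norm (B (x, \<xi>)) \<le> 4 ^ DIM('a) * M * indicator (cball 0 R) \<xi>" for x \<xi>
      using B_bound[of "(x, \<xi>)"] B0[of \<xi> x] by (cases "norm \<xi> \<le> R") auto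
    show "0 \<le> 4 ^ DIM('a) * M" using M0 by simp
    fix x z
    have "(LINT \<xi>|lborel. cis (\<xi> \<bullet> z) * (LINT s|lborel. complex_of_real (exp_kernel m (x - s)) * B (s, \<xi>))) =
       (LINT \<xi>|lborel. cis (\<xi> \<bullet> z) * b (x, \<xi>))"
    proof (rule Bochner_Integration.integral_cong[OF refl])
      fix \<xi>
      have "b (x, \<xi>) = (LINT s|lborel. exp_kernel m (x - s) *\<^sub>R B (s, \<xi>))"
        unfolding B_def
      proof (rule exponential_average_fst[OF m sb bs])
        fix ws us assume "bs = ws @ us"
        then show "\<exists>K. \<forall>p. norm (foldr (\<lambda>b. shift_deriv (1 / m) (b, 0)) us b p) \<le> K"
          using bound by (intro exI allI)
      qed
      then show "cis (\<xi> \<bullet> z) * (LINT s|lborel. complex_of_real (exp_kernel m (x - s)) * B (s, \<xi>)) = cis (\<xi> \<bullet> z) * b (x, \<xi>)"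
        by (simp only: scaleR_conv_of_real)
    qed
    also have "\<dots> = (\<Prod>b\<in>Basis. 1 + \<i> * m * (z \<bullet> b)) * (LINT \<xi>|lborel. cis (\<xi> \<bullet> z) * a (x, \<xi>))"
      unfolding b_def using fourier_shift_derivs[OF a assms(8) bs(1), of R z m x] bs(2) by simp
    finally have 1: "(LINT \<xi>|lborel. cis (\<xi> \<bullet> z) * (LINT s|lborel. complex_of_real (exp_kernel m (x - s)) * B (s, \<xi>))) = \<dots>" .
    have "resolvent m z * (\<Prod>b\<in>Basis. 1 + \<i> * m * (z \<bullet> b)) = 1"
      unfolding resolvent_def prod.distrib[symmetric]
    proof (rule prod.neutral, rule)
      fix b :: 'a
      show "resolvent1 m (z \<bullet> b) * (1 + \<i> * m * (z \<bullet> b)) = 1"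
        using resolvent1_denom_nz[of "m * (z \<bullet> b)"] by (simp add: resolvent1_def mult.assoc)
    qed
    then show "(LINT \<xi>|lborel. cis (\<xi> \<bullet> z) * a (x, \<xi>)) = resolvent m z *
      (LINT \<xi>|lborel. cis (\<xi> \<bullet> z) * (LINT s|lborel. complex_of_real (exp_kernel m (x - s)) * B (s, \<xi>)))"
      unfolding 1 by (simp only: mult.assoc[symmetric] mult_1_left)
  qed
qed

section \<open>Multi-indices, matrix symbols and the operator norm\<close>

lemma sub_deriv_bounded_linear:
  assumes L: "bounded_linear L" and f: "smooth f" and d: "d ` set vs \<subseteq> Basis"
  shows "sub_deriv d J vs (\<lambda>p. L (f p)) = (\<lambda>p. L (sub_deriv d J vs f p))"
  using d
proof (induction vs)
  case (Cons i vs)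
  have "smooth (sub_deriv d J vs f)"
    using Cons.prems by (intro smooth_sub_deriv f) auto
  then have "partial_deriv (d i) (\<lambda>p. L (sub_deriv d J vs f p)) = (\<lambda>p. L (partial_deriv (d i) (sub_deriv d J vs f) p))"
    by (intro ext partial_deriv_bounded_linear L smooth_differentiable)
  with Cons show ?case by (simp add: sub_deriv_def)
qed (simp add: sub_deriv_def)

text \<open>
  The canonical basis, in the order in which \<open>multi_deriv\<close> enumerates the coordinates.
\<close>

definition axes :: "(real^'d::finite) list"
  where "axes = map (\<lambda>i. axis i 1) coords"

lemma set_axes: "set (axes :: (real^'d::finite) list) = Basis"
  unfolding axes_def by (auto simp: set_coords Basis_vec_def)

lemma distinct_axes: "distinct (axes :: (real^'d::finite) list)"
  unfolding axes_def by (auto simp: distinct_map distinct_coords inj_on_def axis_eq_axis)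

lemma symbol_deriv_eq_sub_deriv:
  fixes a :: "(real^'d::finite) \<times> (real^'d) \<Rightarrow> 'b::real_normed_vector"
  shows "sub_deriv (case_sum (\<lambda>b. (b, 0)) (\<lambda>b. (0, b))) J (map Inl axes @ map Inr axes) a =
    symbol_deriv (\<lambda>i. of_bool (Inl (axis i 1) \<in> J)) (\<lambda>i. of_bool (Inr (axis i 1) \<in> J)) a"
proof -
  have pow: "f ^^ of_bool P = (if P then f else id)" for f :: "'x \<Rightarrow> 'x" and P by simp
  show ?thesis
    unfolding sub_deriv_def symbol_deriv_def multi_deriv_def axes_def pow
    by (simp add: foldr_map o_def cong: if_cong)
qed

lemma prod_scale_axes:
  fixes J :: "((real^'d::finite) + (real^'d)) set"
  assumes J: "J \<subseteq> set (map Inl axes @ map Inr axes)"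
  shows "(\<Prod>i\<in>J. case_sum (\<lambda>_. p) (\<lambda>_. q) i) =
    p ^ order_mi (\<lambda>i. of_bool (Inl (axis i 1) \<in> J)) * (q::real) ^ order_mi (\<lambda>i. of_bool (Inr (axis i 1) \<in> J))"
proof -
  let ?A = "{i::'d. Inl (axis i 1) \<in> J}" and ?B = "{i::'d. Inr (axis i 1) \<in> J}"
  let ?X = "(\<lambda>i. Inl (axis i 1)) ` ?A :: ((real^'d) + (real^'d)) set"
    and ?Y = "(\<lambda>i. Inr (axis i 1)) ` ?B :: ((real^'d) + (real^'d)) set"
    and ?f = "case_sum (\<lambda>_. p) (\<lambda>_. q) :: (real^'d) + (real^'d) \<Rightarrow> real"
  have JAB: "J = ?X \<union> ?Y"
    using J by (auto simp: axes_def)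
  have o: "order_mi (\<lambda>i::'d. of_bool (P i)) = card {i. P i}" for P
    unfolding order_mi_def by (simp add: of_bool_def sum.If_cases)
  have "prod ?f J = prod ?f (?X \<union> ?Y)" by (rule arg_cong[OF JAB])
  also have "\<dots> = prod ?f ?X * prod ?f ?Y" by (rule prod.union_disjoint) auto
  also have "prod ?f ?X = p ^ card ?A"
    by (subst prod.reindex) (auto simp: inj_on_def axis_eq_axis)
  also have "prod ?f ?Y = q ^ card ?B"
    by (subst prod.reindex) (auto simp: inj_on_def axis_eq_axis)
  finally show ?thesis by (simp add: o)
qed

lemma le_power_of_powr_le:
  assumes lam: "lam > 0" and r: "r > 0" and k: "k \<ge> 1" and le: "r powr (2 / real k) \<le> lam"
  shows "r \<le> sqrt lam ^ k"
proof -
  have "r = (r powr (2 / real k)) powr (real k / 2)"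
    using r k by (simp add: powr_powr)
  also have "\<dots> \<le> lam powr (real k / 2)"
    using le by (intro powr_mono2) auto
  also have "\<dots> = (lam powr (1 / 2)) powr real k"
    by (simp add: powr_powr)
  also have "\<dots> = sqrt lam ^ k"
    using lam by (simp add: powr_half_sqrt powr_realpow)
  finally show ?thesis .
qed

text \<open>
  The lower bound on \<open>lam\<close>, solved for the coefficients.
\<close>

lemma coefficient_le:
  fixes c :: "'d::finite multi_index \<Rightarrow> 'd multi_index \<Rightarrow> real"
  assumes lam: "lam > 0"
    and c: "\<And>\<alpha> \<beta>. order_mi \<alpha> + order_mi \<beta> \<le> N \<Longrightarrow> c \<alpha> \<beta> > 0"
    and max: "lam \<ge> Max {(c \<alpha> \<beta> / c (\<lambda>_. 0) (\<lambda>_. 0)) powr (2 / real (order_mi \<alpha> + order_mi \<beta>)) | \<alpha> \<beta>.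
        1 \<le> order_mi \<alpha> + order_mi \<beta> \<and> order_mi \<alpha> + order_mi \<beta> \<le> N}"
    and N: "order_mi \<alpha> + order_mi \<beta> \<le> N"
  shows "c \<alpha> \<beta> \<le> c (\<lambda>_. 0) (\<lambda>_. 0) * sqrt lam ^ (order_mi \<alpha> + order_mi \<beta>)"
proof (cases "order_mi \<alpha> + order_mi \<beta> = 0")
  case True
  then have "\<alpha> = (\<lambda>_. 0)" "\<beta> = (\<lambda>_. 0)" by (auto simp: order_mi_def)
  then show ?thesis by (simp add: order_mi_def)
next
  case False
  let ?S = "{(c \<alpha> \<beta> / c (\<lambda>_. 0) (\<lambda>_. 0)) powr (2 / real (order_mi \<alpha> + order_mi \<beta>)) | \<alpha> \<beta>.
        1 \<le> order_mi \<alpha> + order_mi \<beta> \<and> order_mi \<alpha> + order_mi \<beta> \<le> N}"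
  have eq: "?S = (\<lambda>(\<alpha>, \<beta>). (c \<alpha> \<beta> / c (\<lambda>_. 0) (\<lambda>_. 0)) powr (2 / real (order_mi \<alpha> + order_mi \<beta>))) `
      {(\<alpha>, \<beta>). 1 \<le> order_mi \<alpha> + order_mi \<beta> \<and> order_mi \<alpha> + order_mi \<beta> \<le> N}" by auto
  have fin: "finite ?S"
    unfolding eq by (intro finite_imageI finite_multi_index_pairs)
  have pos: "c (\<lambda>_. 0) (\<lambda>_. 0) > 0" "c \<alpha> \<beta> > 0" using c N by (auto simp: order_mi_def)
  have "(c \<alpha> \<beta> / c (\<lambda>_. 0) (\<lambda>_. 0)) powr (2 / real (order_mi \<alpha> + order_mi \<beta>)) \<in> ?S"
    using False N by (intro CollectI exI[of _ \<alpha>] exI[of _ \<beta>]) auto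
  then have "(c \<alpha> \<beta> / c (\<lambda>_. 0) (\<lambda>_. 0)) powr (2 / real (order_mi \<alpha> + order_mi \<beta>)) \<le> lam"
    using Max_ge[OF fin] max by (meson order_trans)
  then have "c \<alpha> \<beta> / c (\<lambda>_. 0) (\<lambda>_. 0) \<le> sqrt lam ^ (order_mi \<alpha> + order_mi \<beta>)"
    using lam pos False by (intro le_power_of_powr_le) auto
  then show ?thesis using pos by (simp add: divide_le_eq mult.commute)
qed

lemma L2_opnorm_le:
  fixes T :: "('a::euclidean_space \<Rightarrow> 'b::euclidean_space) \<Rightarrow> 'a \<Rightarrow> 'c::euclidean_space"
  assumes K: "0 \<le> K"
    and meas: "\<And>u. u \<in> L1_space \<Longrightarrow> T u \<in> borel_measurable lborel"
    and le: "\<And>u. u \<in> L1_space \<Longrightarrow> (\<integral>\<^sup>+ x. ennreal ((norm (T u x))\<^sup>2) \<partial>lborel) \<le>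
      ennreal (K\<^sup>2) * (\<integral>\<^sup>+ x. ennreal ((norm (u x))\<^sup>2) \<partial>lborel)"
  shows "L2_opnorm T \<le> ennreal K"
  unfolding L2_opnorm_def
proof (rule Inf_lower, intro CollectI exI conjI ballI)
  show "ennreal K = ennreal K" "0 \<le> K" by (simp_all add: K)
  fix u :: "'a \<Rightarrow> 'b" assume u: "u \<in> L1_space \<inter> L2_space"
  note [measurable] = meas[OF IntD1[OF u]]
  have iu: "integrable lborel (\<lambda>x. (norm (u x))\<^sup>2)" using u by (simp add: L2_space_def)
  have "(\<integral>\<^sup>+ x. ennreal ((norm (T u x))\<^sup>2) \<partial>lborel) \<le> ennreal (K\<^sup>2 * (LINT x|lborel. (norm (u x))\<^sup>2))"
    using le[OF IntD1[OF u]] nn_integral_eq_integral[OF iu] by (simp add: ennreal_mult)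
  moreover from this have iT: "integrable lborel (\<lambda>x. (norm (T u x))\<^sup>2)"
    by (intro integrableI_nonneg) (auto simp: less_top[symmetric] top_unique)
  ultimately have "ennreal (LINT x|lborel. (norm (T u x))\<^sup>2) \<le> ennreal (K\<^sup>2 * (LINT x|lborel. (norm (u x))\<^sup>2))"
    using nn_integral_eq_integral[OF iT] by simp
  then have "(LINT x|lborel. (norm (T u x))\<^sup>2) \<le> K\<^sup>2 * (LINT x|lborel. (norm (u x))\<^sup>2)"
    by (simp add: ennreal_le_iff)
  then have "sqrt (LINT x|lborel. (norm (T u x))\<^sup>2) \<le> sqrt (K\<^sup>2 * (LINT x|lborel. (norm (u x))\<^sup>2))"
    by (rule real_sqrt_le_mono)
  then show "L2_norm (T u) \<le> K * L2_norm u"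
    using K by (simp add: L2_norm_def real_sqrt_mult)
  show "T u \<in> L2_space" using iT by (simp add: L2_space_def)
qed

lemma bounded_linear_axis: "bounded_linear (axis i :: 'b::euclidean_space \<Rightarrow> 'b^'n::finite)"
  unfolding linear_conv_bounded_linear[symmetric]
  by (rule linearI) (auto simp: axis_def vec_eq_iff)

lemma norm_axis: "norm (axis i x) = norm x"
  by (simp add: norm_vec_def L2_set_def axis_def if_distrib[of norm] if_distrib[of "\<lambda>y. y\<^sup>2"] cong: if_cong)

lemma matrix_vector_mult_eq_sum_axis:
  fixes A :: "complex^'n::finite^'m::finite"
  shows "c *s (A *v v) = (\<Sum>(i, j)\<in>UNIV. axis i (c * (A $ i $ j * v $ j)))"
proof -
  have "(\<Sum>(i, j)\<in>UNIV. axis i (c * (A $ i $ j * v $ j))) $ k = (c *s (A *v v)) $ k" for k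
  proof -
    have "(\<Sum>(i, j)\<in>UNIV. axis i (c * (A $ i $ j * v $ j))) $ k =
        (\<Sum>i\<in>UNIV. \<Sum>j\<in>UNIV. axis i (c * (A $ i $ j * v $ j)) $ k)"
      by (simp add: sum.cartesian_product case_prod_unfold)
    also have "\<dots> = (\<Sum>i\<in>UNIV. if i = k then (\<Sum>j\<in>UNIV. c * (A $ k $ j * v $ j)) else 0)"
      by (intro sum.cong) (auto simp: axis_def)
    also have "\<dots> = (c *s (A *v v)) $ k"
      by (simp add: matrix_vector_mult_def sum_distrib_left)
    finally show ?thesis .
  qed
  then show ?thesis by (simp add: vec_eq_iff)
qed

text \<open>
  A matrix-valued operator as the sum of the scalar operators given by its entries.
\<close>

lemma left_quantization_eq_sum:
  fixes a :: "(real^'d::finite) \<times> (real^'d) \<Rightarrow> complex^'n::finite^'m::finite"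
  assumes a: "continuous_on UNIV a" and a_le: "\<And>x \<xi>. norm (a (x, \<xi>)) \<le> M * indicator (cball 0 R) \<xi>"
    and u: "integrable lborel u"
  shows "left_quantization a u x = (1 / (2 * pi) ^ CARD('d)) *\<^sub>R (\<Sum>(i, j)\<in>UNIV. axis i
    (LINT \<xi>|lborel. LINT y|lborel. cis (\<xi> \<bullet> (x - y)) * (a (x, \<xi>) $ i $ j * u y $ j)))"
proof -
  have [measurable]: "u \<in> borel_measurable borel" using u by auto
  let ?g = "\<lambda>i j \<xi> y. cis (\<xi> \<bullet> (x - y)) * (a (x, \<xi>) $ i $ j * u y $ j)"
  have ent: "norm (a (x, \<xi>) $ i $ j) \<le> M * indicator (cball 0 R) \<xi>" for \<xi> i j
    by (meson a_le Finite_Cartesian_Product.norm_nth_le order_trans)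
  have iu: "integrable lborel (\<lambda>y. u y $ j)" for j
    by (rule integrable_bounded_linear[OF bounded_linear_vec_nth u])
  then have iun: "integrable lborel (\<lambda>y. norm (u y $ j))" for j by auto
  have ind: "integrable lborel (\<lambda>\<xi>. M * indicator (cball (0 :: real^'d) R) \<xi>)"
    by (intro integrable_mult_right integrable_indicator_cball)
  have [measurable]: "(\<lambda>\<xi>. a (x, \<xi>) $ i $ j) \<in> borel_measurable borel" for i j
    by (intro borel_measurable_continuous_onI continuous_intros continuous_on_compose2[OF a]) auto
  have [measurable]: "(\<lambda>y. u y $ j) \<in> borel_measurable borel" for j using iu[of j] by auto
  have inner: "integrable lborel (?g i j \<xi>)" for i j \<xi>
    by (rule Bochner_Integration.integrable_bound[OF integrable_mult_right[OF iun, of "norm (a (x, \<xi>) $ i $ j)"]])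
      (auto simp: norm_mult)
  have outer: "integrable lborel (\<lambda>\<xi>. LINT y|lborel. ?g i j \<xi> y)" for i j
  proof (rule Fubini_dominated(2)[OF _ ind iun])
    show "norm (?g i j \<xi> y) \<le> M * indicator (cball 0 R) \<xi> * norm (u y $ j)" for \<xi> y
      using mult_right_mono[OF ent norm_ge_zero, of \<xi> i j "u y $ j"] by (simp add: norm_mult)
  qed measurable
  have "(LINT y|lborel. cis (\<xi> \<bullet> (x - y)) *s (a (x, \<xi>) *v u y)) =
      (\<Sum>(i, j)\<in>UNIV. axis i (LINT y|lborel. ?g i j \<xi> y))" for \<xi>
    unfolding matrix_vector_mult_eq_sum_axis case_prod_unfold
    by (subst Bochner_Integration.integral_sum)
      (auto intro!: integrable_bounded_linear[OF bounded_linear_axis] inner sum.cong integral_bounded_linear[OF bounded_linear_axis])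
  then have "left_quantization a u x = (1 / (2 * pi) ^ CARD('d)) *\<^sub>R
      (LINT \<xi>|lborel. (\<Sum>(i, j)\<in>UNIV. axis i (LINT y|lborel. ?g i j \<xi> y)))"
    by (simp only: left_quantization_def)
  also have "(LINT \<xi>|lborel. (\<Sum>(i, j)\<in>UNIV. axis i (LINT y|lborel. ?g i j \<xi> y))) =
      (\<Sum>(i, j)\<in>UNIV. axis i (LINT \<xi>|lborel. LINT y|lborel. ?g i j \<xi> y))"
    unfolding case_prod_unfold
    by (subst Bochner_Integration.integral_sum)
      (auto intro!: integrable_bounded_linear[OF bounded_linear_axis] outer sum.cong integral_bounded_linear[OF bounded_linear_axis])
  finally show ?thesis .
qed

theorem lemma2p10:
  shows "\<exists>C::real. C > 0 \<and>
    (\<forall>(lam::real) (a :: (real^'d::finite) \<times> (real^'d) \<Rightarrow> complex^'n::finite^'m::finite)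
      (c :: 'd multi_index \<Rightarrow> 'd multi_index \<Rightarrow> real).
      lam > 0 \<longrightarrow>
      smooth a \<longrightarrow>
      (\<forall>\<alpha> \<beta>. order_mi \<alpha> + order_mi \<beta> \<le> 100 * CARD('d) \<longrightarrow>
        c \<alpha> \<beta> > 0 \<and>
        (\<forall>x \<xi>. norm (symbol_deriv \<alpha> \<beta> a (x, \<xi>)) \<le> c \<alpha> \<beta> * lam powi (- int (order_mi \<beta>)))) \<longrightarrow>
      closure {p. a p \<noteq> 0} \<subseteq> {(x, \<xi>). 1 / 100 * lam < norm \<xi> \<and> norm \<xi> < 100 * lam} \<longrightarrow>
      lam \<ge> Max {(c \<alpha> \<beta> / c (\<lambda>_. 0) (\<lambda>_. 0)) powr (2 / real (order_mi \<alpha> + order_mi \<beta>)) | \<alpha> \<beta>.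
        1 \<le> order_mi \<alpha> + order_mi \<beta> \<and> order_mi \<alpha> + order_mi \<beta> \<le> 10 * CARD('d)} \<longrightarrow>
      L2_opnorm (left_quantization a) \<le> ennreal (C * c (\<lambda>_. 0) (\<lambda>_. 0)))"
proof -
  let ?d = "CARD('d)"
  define C0 where "C0 = sqrt ((32 * pi ^ 3) ^ ?d) * 4 ^ ?d"
  define N where "N = real (CARD('m) * CARD('n))"
  define c0 where "c0 = 1 / (2 * pi) ^ ?d"
  have pos: "C0 > 0" "N > 0" "c0 > 0" by (auto simp: C0_def N_def c0_def)
  have C0_sq: "(32 * pi ^ 3) ^ ?d * (4 ^ ?d * M)\<^sup>2 = (C0 * M)\<^sup>2" for M
    by (simp add: C0_def power_mult_distrib)
  show ?thesis
  proof (intro exI[of _ "c0 * N * C0"] conjI allI impI)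
    show "c0 * N * C0 > 0" using pos by simp
    fix lam :: real and a :: "(real^'d) \<times> (real^'d) \<Rightarrow> complex^'n^'m"
      and c :: "'d multi_index \<Rightarrow> 'd multi_index \<Rightarrow> real"
    assume lam: "lam > 0" and a: "smooth a"
      and bnd: "\<forall>\<alpha> \<beta>. order_mi \<alpha> + order_mi \<beta> \<le> 100 * CARD('d) \<longrightarrow>
        c \<alpha> \<beta> > 0 \<and>
        (\<forall>x \<xi>. norm (symbol_deriv \<alpha> \<beta> a (x, \<xi>)) \<le> c \<alpha> \<beta> * lam powi (- int (order_mi \<beta>)))"
      and supp: "closure {p. a p \<noteq> 0} \<subseteq> {(x, \<xi>). 1 / 100 * lam < norm \<xi> \<and> norm \<xi> < 100 * lam}"
      and max: "lam \<ge> Max {(c \<alpha> \<beta> / c (\<lambda>_. 0) (\<lambda>_. 0)) powr (2 / real (order_mi \<alpha> + order_mi \<beta>)) | \<alpha> \<beta>.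
        1 \<le> order_mi \<alpha> + order_mi \<beta> \<and> order_mi \<alpha> + order_mi \<beta> \<le> 10 * CARD('d)}"
    define M where "M = c (\<lambda>_. 0) (\<lambda>_. 0)"
    \<comment> \<open>Differentiations in \<open>x\<close> cost \<open>m\<close> and differentiations in \<open>\<xi>\<close> cost \<open>1 / m\<close>.\<close>
    define m where "m = sqrt lam"
    have m: "m > 0" and m2: "m\<^sup>2 = lam" using lam by (auto simp: m_def)
    have c_pos: "c \<alpha> \<beta> > 0" if "order_mi \<alpha> + order_mi \<beta> \<le> 10 * CARD('d)" for \<alpha> \<beta>
      using bnd that by auto
    have z: "a (x, \<xi>) = 0" if "norm \<xi> > 100 * lam" for x \<xi>
    proof (rule ccontr)
      assume "a (x, \<xi>) \<noteq> 0"
      then have "(x, \<xi>) \<in> {p. a p \<noteq> 0}" by simp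
      then have "(x, \<xi>) \<in> closure {p. a p \<noteq> 0}" by (rule subsetD[OF closure_subset])
      then show False using supp that by auto
    qed
    let ?D = "case_sum (\<lambda>b. (b, 0)) (\<lambda>b. (0, b)) :: (real^'d) + (real^'d) \<Rightarrow> (real^'d) \<times> (real^'d)"
    let ?dirs = "map Inl axes @ map Inr axes :: ((real^'d) + (real^'d)) list"
    let ?\<kappa> = "case_sum (\<lambda>_. 1 / m) (\<lambda>_. - m) :: (real^'d) + (real^'d) \<Rightarrow> real"
    have sub: "?D ` set ?dirs \<subseteq> Basis" by (auto simp: set_axes Basis_prod_def)
    have M_bound: "norm ((\<Prod>i\<in>J. ?\<kappa> i) *\<^sub>R sub_deriv ?D J ?dirs a p) \<le> M" if J: "J \<subseteq> set ?dirs" for J p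
    proof -
      let ?\<alpha> = "\<lambda>i. of_bool (Inl (axis i 1) \<in> J) :: nat" and ?\<beta> = "\<lambda>i. of_bool (Inr (axis i 1) \<in> J) :: nat"
      let ?A = "order_mi ?\<alpha>" and ?B = "order_mi ?\<beta>"
      have "?A \<le> (\<Sum>i\<in>(UNIV::'d set). 1)" "?B \<le> (\<Sum>i\<in>(UNIV::'d set). 1)"
        unfolding order_mi_def by (rule sum_mono, simp)+
      then have AB: "?A + ?B \<le> 10 * ?d" "?A + ?B \<le> 100 * ?d" by auto
      have cab: "c ?\<alpha> ?\<beta> \<le> M * m ^ (?A + ?B)"
        unfolding M_def m_def by (rule coefficient_le[OF lam c_pos max AB(1)])
      have "norm (symbol_deriv ?\<alpha> ?\<beta> a p) \<le> c ?\<alpha> ?\<beta> * lam powi (- int ?B)"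
        using bnd AB(2) by (cases p) auto
      also have "lam powi (- int ?B) = 1 / (m ^ ?B * m ^ ?B)"
        by (simp add: power_int_minus m2[symmetric] power_mult_distrib power2_eq_square divide_inverse)
      also have "c ?\<alpha> ?\<beta> * (1 / (m ^ ?B * m ^ ?B)) \<le> (M * m ^ (?A + ?B)) * (1 / (m ^ ?B * m ^ ?B))"
        using m by (intro mult_right_mono cab) auto
      finally have le: "norm (symbol_deriv ?\<alpha> ?\<beta> a p) \<le> M * m ^ ?A / m ^ ?B"
        using m by (simp add: power_add)
      have "norm ((\<Prod>i\<in>J. ?\<kappa> i) *\<^sub>R sub_deriv ?D J ?dirs a p) = m ^ ?B / m ^ ?A * norm (symbol_deriv ?\<alpha> ?\<beta> a p)"
        unfolding symbol_deriv_eq_sub_deriv prod_scale_axes[OF J] norm_scaleR abs_mult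
        using m by (simp add: power_abs power_divide)
      also have "\<dots> \<le> m ^ ?B / m ^ ?A * (M * m ^ ?A / m ^ ?B)"
        using m by (intro mult_left_mono le) auto
      also have "\<dots> = M" using m by simp
      finally show ?thesis .
    qed
    have a_bound: "norm (a p) \<le> M" for p
      using M_bound[of "{}" p] sub_deriv_append_outside[of "{}" ?dirs ?D "[]" a]
      by (simp add: sub_deriv_def[of ?D "{}" "[]"])
    have M0: "0 \<le> M" by (rule order_trans[OF norm_ge_zero a_bound])
    have a_ind: "norm (a (x, \<xi>)) \<le> M * indicator (cball 0 (100 * lam)) \<xi>" for x \<xi>
      using a_bound[of "(x, \<xi>)"] z[of \<xi> x] by (cases "norm \<xi> \<le> 100 * lam") auto
    have ca: "continuous_on UNIV a" by (rule smooth_continuous_on[OF a])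

    define I where "I u i j x = (LINT \<xi>|lborel. LINT y|lborel.
        cis (\<xi> \<bullet> (x - y)) * (a (x, \<xi>) $ i $ j * (u y :: complex^'n) $ j))" for u i j x
    have Tu: "left_quantization a u x = c0 *\<^sub>R (\<Sum>(i, j)\<in>UNIV. axis i (I u i j x))"
      if "u \<in> L1_space" for u x
      unfolding I_def c0_def using that
      by (intro left_quantization_eq_sum[OF ca a_ind]) (simp add: L1_space_def)
    have I_meas: "I u i j \<in> borel_measurable borel" if "u \<in> L1_space" for u i j
    proof -
      have [measurable]: "(\<lambda>y. u y $ j) \<in> borel_measurable borel"
        using that integrable_bounded_linear[OF bounded_linear_vec_nth, of lborel u j] by (auto simp: L1_space_def)
      have [measurable]: "(\<lambda>p. a p $ i $ j) \<in> borel_measurable (borel \<Otimes>\<^sub>M borel)"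
        unfolding borel_prod by (intro borel_measurable_continuous_onI continuous_intros ca)
      have "(\<lambda>x. LINT \<xi>|lborel. LINT y|lborel. cis (\<xi> \<bullet> (x - y)) * (a (x, \<xi>) $ i $ j * u y $ j)) \<in> borel_measurable borel"
        by measurable
      then show ?thesis by (simp add: I_def[abs_def])
    qed
    have I_le: "(\<integral>\<^sup>+ x. ennreal ((norm (I u i j x))\<^sup>2) \<partial>lborel) \<le>
        ennreal ((C0 * M)\<^sup>2) * (\<integral>\<^sup>+ y. ennreal ((norm (u y))\<^sup>2) \<partial>lborel)" if u: "u \<in> L1_space" for u i j
    proof -
      have L: "bounded_linear (\<lambda>A::complex^'n^'m. A $ i $ j)"
        by (rule bounded_linear_compose[OF bounded_linear_vec_nth bounded_linear_vec_nth])
      have "(\<integral>\<^sup>+ x. ennreal ((norm (I u i j x))\<^sup>2) \<partial>lborel) \<le>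
        ennreal ((32 * pi ^ 3) ^ DIM(real^'d) * (4 ^ DIM(real^'d) * M)\<^sup>2) * (\<integral>\<^sup>+ y. ennreal ((norm (u y $ j))\<^sup>2) \<partial>lborel)"
        unfolding I_def
      proof (rule nn_integral_symbol_le[OF m _ distinct_axes set_axes])
        show "smooth (\<lambda>p. a p $ i $ j)" by (rule smooth_bounded_linear[OF L a])
        show "a (x, \<xi>) $ i $ j = 0" if "norm \<xi> > 100 * lam" for x \<xi> using z[OF that] by simp
        show "integrable lborel (\<lambda>y. u y $ j)"
          using u integrable_bounded_linear[OF bounded_linear_vec_nth, of lborel u j] by (simp add: L1_space_def)
        fix J :: "((real^'d) + (real^'d)) set" and p assume J: "J \<subseteq> set ?dirs"
        have "norm (sub_deriv ?D J ?dirs (\<lambda>p. a p $ i $ j) p) \<le> norm (sub_deriv ?D J ?dirs a p)"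
          unfolding sub_deriv_bounded_linear[OF L a sub] by (meson Finite_Cartesian_Product.norm_nth_le order_trans)
        then have "norm ((\<Prod>i\<in>J. ?\<kappa> i) *\<^sub>R sub_deriv ?D J ?dirs (\<lambda>p. a p $ i $ j) p) \<le>
            norm ((\<Prod>i\<in>J. ?\<kappa> i) *\<^sub>R sub_deriv ?D J ?dirs a p)"
          unfolding norm_scaleR by (intro mult_left_mono) auto
        also have "\<dots> \<le> M" by (rule M_bound[OF J])
        finally show "norm ((\<Prod>i\<in>J. ?\<kappa> i) *\<^sub>R sub_deriv ?D J ?dirs (\<lambda>p. a p $ i $ j) p) \<le> M" .
      qed
      also have "\<dots> = ennreal ((C0 * M)\<^sup>2) * (\<integral>\<^sup>+ y. ennreal ((norm (u y $ j))\<^sup>2) \<partial>lborel)"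
        by (simp only: DIM_cart DIM_real mult_1_right C0_sq)
      also have "\<dots> \<le> ennreal ((C0 * M)\<^sup>2) * (\<integral>\<^sup>+ y. ennreal ((norm (u y))\<^sup>2) \<partial>lborel)"
        by (intro mult_left_mono nn_integral_mono ennreal_leI power_mono Finite_Cartesian_Product.norm_nth_le) auto
      finally show ?thesis .
    qed
    have "L2_opnorm (left_quantization a) \<le> ennreal (c0 * N * C0 * M)"
    proof (rule L2_opnorm_le)
      show "0 \<le> c0 * N * C0 * M" using pos M0 by simp
      fix u :: "real^'d \<Rightarrow> complex^'n" assume u: "u \<in> L1_space"
      note [measurable] = I_meas[OF u]
      have "(\<lambda>x. axis i (I u i j x) :: complex^'m) \<in> borel_measurable borel" for i j
        by (rule borel_measurable_continuous_on[OF _ I_meas[OF u]])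
          (rule linear_continuous_on[OF bounded_linear_axis])
      then have "(\<lambda>x. c0 *\<^sub>R (\<Sum>(i, j)\<in>UNIV. axis i (I u i j x)) :: complex^'m) \<in> borel_measurable borel"
        by (simp add: case_prod_unfold)
      then show "left_quantization a u \<in> borel_measurable lborel"
        using Tu[OF u] by (simp add: fun_eq_iff cong: measurable_cong)
      have pt: "(norm (left_quantization a u x))\<^sup>2 \<le> c0\<^sup>2 * N * (\<Sum>(i, j)\<in>UNIV. (norm (I u i j x))\<^sup>2)" for x
      proof -
        have "norm (\<Sum>(i, j)\<in>UNIV. axis i (I u i j x) :: complex^'m) \<le> (\<Sum>(i::'m, j::'n)\<in>UNIV. norm (I u i j x))"
          unfolding case_prod_unfold by (rule order_trans[OF norm_sum]) (simp add: norm_axis)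
        then have "(norm (\<Sum>(i, j)\<in>UNIV. axis i (I u i j x) :: complex^'m))\<^sup>2 \<le> (\<Sum>(i::'m, j::'n)\<in>UNIV. norm (I u i j x))\<^sup>2"
          by (intro power_mono) auto
        also have "\<dots> \<le> (\<Sum>(i::'m, j::'n)\<in>UNIV. (norm (I u i j x))\<^sup>2) * N"
          using sum_squared_le_sum_of_squares[of "\<lambda>(i::'m, j::'n). norm (I u i j x)" UNIV]
          by (simp add: N_def case_prod_unfold)
        finally have "c0\<^sup>2 * (norm (\<Sum>(i, j)\<in>UNIV. axis i (I u i j x) :: complex^'m))\<^sup>2 \<le>
            c0\<^sup>2 * ((\<Sum>(i::'m, j::'n)\<in>UNIV. (norm (I u i j x))\<^sup>2) * N)"
          by (intro mult_left_mono) auto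
        then show ?thesis unfolding Tu[OF u] by (simp add: power_mult_distrib mult_ac)
      qed
      let ?n = "\<integral>\<^sup>+ y. ennreal ((norm (u y))\<^sup>2) \<partial>lborel"
      have "(\<integral>\<^sup>+ x. ennreal ((norm (left_quantization a u x))\<^sup>2) \<partial>lborel) \<le>
          (\<integral>\<^sup>+ x. ennreal (c0\<^sup>2 * N) * (\<Sum>(i::'m, j::'n)\<in>UNIV. ennreal ((norm (I u i j x))\<^sup>2)) \<partial>lborel)"
      proof (rule nn_integral_mono)
        fix x
        have "ennreal ((norm (left_quantization a u x))\<^sup>2) \<le> ennreal (c0\<^sup>2 * N * (\<Sum>(i::'m, j::'n)\<in>UNIV. (norm (I u i j x))\<^sup>2))"
          by (rule ennreal_leI[OF pt])
        also have "\<dots> = ennreal (c0\<^sup>2 * N) * (\<Sum>(i::'m, j::'n)\<in>UNIV. ennreal ((norm (I u i j x))\<^sup>2))"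
          using pos by (simp add: ennreal_mult case_prod_unfold sum_nonneg)
        finally show "ennreal ((norm (left_quantization a u x))\<^sup>2) \<le> \<dots>" .
      qed
      also have "\<dots> = ennreal (c0\<^sup>2 * N) * (\<Sum>(i::'m, j::'n)\<in>UNIV. \<integral>\<^sup>+ x. ennreal ((norm (I u i j x))\<^sup>2) \<partial>lborel)"
        unfolding case_prod_unfold
        by (subst nn_integral_cmult, measurable, subst nn_integral_sum, measurable)
      also have "\<dots> \<le> ennreal (c0\<^sup>2 * N) * (\<Sum>(i::'m, j::'n)\<in>UNIV. ennreal ((C0 * M)\<^sup>2) * ?n)"
        unfolding case_prod_unfold by (intro mult_left_mono sum_mono I_le u) simp
      also have "\<dots> = ennreal (c0\<^sup>2 * N) * (ennreal N * (ennreal ((C0 * M)\<^sup>2) * ?n))"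
        by (simp add: N_def case_prod_unfold ennreal_of_nat_eq_real_of_nat)
      also have "\<dots> = ennreal ((c0 * N * C0 * M)\<^sup>2) * ?n"
      proof -
        have "(c0 * N * C0 * M)\<^sup>2 = c0\<^sup>2 * N * (N * (C0 * M)\<^sup>2)"
          by (simp add: power2_eq_square)
        then have "ennreal ((c0 * N * C0 * M)\<^sup>2) = ennreal (c0\<^sup>2 * N) * (ennreal N * ennreal ((C0 * M)\<^sup>2))"
          using pos by (simp only: ennreal_mult[symmetric] zero_le_power2 less_imp_le mult_nonneg_nonneg)
        then show ?thesis by (simp only: mult.assoc)
      qed
      finally show "(\<integral>\<^sup>+ x. ennreal ((norm (left_quantization a u x))\<^sup>2) \<partial>lborel) \<le> ennreal ((c0 * N * C0 * M)\<^sup>2) * ?n" .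
    qed
    then show "L2_opnorm (left_quantization a) \<le> ennreal (c0 * N * C0 * c (\<lambda>_. 0) (\<lambda>_. 0))"
      by (simp only: M_def)
  qed
qed

end
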